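(* Let $0<\omega_1<\omega_2<\dots$ be a strictly increasing sequence of positive real numbers, let $r\in\mathbb N$, let $(c_{sj})_{s=1,\dots,r;\ j\ge 1}$ be real numbers with $\sum_{j=1}^\infty c_{sj}^2<\infty$ for every $s$, and let $\gamma_1,\dots,\gamma_r>0$ be arbitrary. Let $A$, $C$, $F$ be the operators defined from these data in the context; in particular $F$ has components $f_{js}=\gamma_s c_{sj}$, $g_{js}=0$. Assume that (i) the series $\sum_{i=1}^\infty \frac{1}{\omega_i^2}$ converges; (ii) the only linear subspace $M\subseteq \operatorname{Ker} C$ that is invariant under the semigroup $\{e^{tA}\}_{t\ge 0}$ (i.e. $e^{tA}M\subseteq M$ for all $t\ge 0$) is $M=\{0\}$; (iii) for each $j\in\mathbb N$ there exists $s\in\{1,\dots,r\}$ such that $c_{sj}\neq 0$. Then the trivial solution $e=0$ of the system $\dot e(t)=(A-FC)e(t)$ in $H$ is asymptotically stable.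
   Context: $\ell^2$ is the real Hilbert space of square-summable real sequences and $H=\ell^2\times\ell^2$, with elements written $z=\begin{pmatrix}\xi\\ \eta\end{pmatrix}$ and inner product $\left\langle \begin{pmatrix}\xi\\ \eta\end{pmatrix},\begin{pmatrix}\tilde\xi\\ \tilde\eta\end{pmatrix}\right\rangle_H=\sum_{j=1}^\infty(\xi_j\tilde\xi_j+\eta_j\tilde\eta_j)$. With $\Omega=\operatorname{diag}(\omega_1,\omega_2,\dots)$, the operator $A:D(A)\to H$ is $A\begin{pmatrix}\xi\\ \eta\end{pmatrix}=\begin{pmatrix}\Omega\eta\\ -\Omega\xi\end{pmatrix}$ with domain $D(A)=\left\{\begin{pmatrix}\xi\\ \eta\end{pmatrix}\in H:\ \sum_{j=1}^\infty\omega_j^2(\xi_j^2+\eta_j^2)<\infty\right\}$. It generates a $C_0$-semigroup $\{e^{tA}\}_{t\ge0}$ on $H$. The output operator $C:H\to\mathbb R^r$ is $C\begin{pmatrix}\xi\\ \eta\end{pmatrix}=C_1\xi$, where $(C_1\xi)_s=\sum_{j=1}^\infty c_{sj}\xi_j$, $s=1,\dots,r$. The operator $F:\mathbb R^r\to H$ is $Fy=\begin{pmatrix}fy\\ gy\end{pmatrix}$, where $f,g:\mathbb R^r\to\ell^2$ are given by $(fy)_j=\sum_{s=1}^r f_{js}y_s$, $(gy)_j=\sum_{s=1}^r g_{js}y_s$ with $f_{js}=\gamma_sc_{sj}$ and $g_{js}=0$. The system $\dot e=(A-FC)e$, with $A-FC$ defined on $D(A)$, is the error dynamics ($e=z-\bar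 z$) of the observer $\dot{\bar z}=(A-FC)\bar z+Bu+Fy$ for the control system $\dot z=Az+Bu$, $y=Cz$. Its solution with $e(0)=e_0\in H$ is the (mild) solution $e(t)=e^{t(A-FC)}e_0$, $t\ge0$. Asymptotic stability of $e=0$ means: $e=0$ is stable in the sense of Lyapunov (for every $\varepsilon>0$ there is $\delta>0$ such that $\|e(0)\|_H<\delta$ implies $\|e(t)\|_H<\varepsilon$ for all $t\ge0$), and $\|e(t)\|_H\to0$ as $t\to+\infty$ for every $e(0)\in H$. *)

theory Defs
  imports "HOL-Analysis.Analysis"
begin

section \<open>The real Hilbert space of square-summable sequences\<close>

text \<open>Sequences are indexed from 0, so index \<open>j\<close> here is index \<open>j + 1\<close> of the usual notation.\<close>

typedef ell2 = "{x :: nat \<Rightarrow> real. summable (\<lambda>j. (x j)\<^sup>2)}"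
  morphisms ell2_nth ell2_of
  by (rule exI[of _ "\<lambda>_. 0"]) simp

lemma ell2_nth_summable: "summable (\<lambda>j. (ell2_nth x j)\<^sup>2)"
  using ell2_nth[of x] by simp

lemma ell2_nth_ell2_of: "summable (\<lambda>j. (a j)\<^sup>2) \<Longrightarrow> ell2_nth (ell2_of a) = a"
  by (simp add: ell2_of_inverse)

lemma ell2_eqI: "(\<And>j. ell2_nth x j = ell2_nth y j) \<Longrightarrow> x = y"
  by (simp add: ell2_nth_inject[symmetric] fun_eq_iff)

lemma summable_mult_of_squares:
  fixes a b :: "nat \<Rightarrow> real"
  assumes "summable (\<lambda>j. (a j)\<^sup>2)" and "summable (\<lambda>j. (b j)\<^sup>2)"
  shows "summable (\<lambda>j. a j * b j)"
proof (rule summable_comparison_test)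
  show "summable (\<lambda>j. (a j)\<^sup>2 + (b j)\<^sup>2)"
    using assms by (rule summable_add)
  have "\<bar>u * v\<bar> \<le> u\<^sup>2 + v\<^sup>2" for u v :: real
  proof -
    have "2 * \<bar>u * v\<bar> \<le> u\<^sup>2 + v\<^sup>2"
      using sum_squares_bound[of "\<bar>u\<bar>" "\<bar>v\<bar>"] by (simp add: abs_mult)
    moreover have "0 \<le> \<bar>u * v\<bar>"
      by simp
    ultimately show ?thesis
      by linarith
  qed
  then show "\<exists>N. \<forall>n\<ge>N. norm (a n * b n) \<le> (a n)\<^sup>2 + (b n)\<^sup>2"
    by simp
qed

lemma summable_square_add:
  fixes a b :: "nat \<Rightarrow> real"
  assumes "summable (\<lambda>j. (a j)\<^sup>2)" and "summable (\<lambda>j. (b j)\<^sup>2)"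
  shows "summable (\<lambda>j. (a j + b j)\<^sup>2)"
  using summable_add[OF summable_add[OF assms]
      summable_mult[OF summable_mult_of_squares[OF assms], of 2]]
  by (simp add: power2_sum mult.assoc)

lemma summable_square_scale:
  fixes a :: "nat \<Rightarrow> real"
  assumes "summable (\<lambda>j. (a j)\<^sup>2)"
  shows "summable (\<lambda>j. (r * a j)\<^sup>2)"
  using summable_mult[OF assms, of "r\<^sup>2"] by (simp add: power_mult_distrib)

instantiation ell2 :: real_inner
begin

definition "0 = ell2_of (\<lambda>_. 0)"
definition "x + y = ell2_of (\<lambda>j. ell2_nth x j + ell2_nth y j)"
definition "- x = ell2_of (\<lambda>j. - ell2_nth x j)"
definition "x - y = ell2_of (\<lambda>j. ell2_nth x j - ell2_nth y j)"
definition "r *\<^sub>R x = ell2_of (\<lambda>j. r * ell2_nth x j)"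
definition "inner x y = (\<Sum>j. ell2_nth x j * ell2_nth y j)"
definition "norm (x :: ell2) = sqrt (inner x x)"
definition "dist (x :: ell2) y = norm (x - y)"
definition "sgn (x :: ell2) = inverse (norm x) *\<^sub>R x"
definition "uniformity = (INF e\<in>{0<..}. principal {(x :: ell2, y). dist x y < e})"
definition "open (U :: ell2 set) \<longleftrightarrow>
  (\<forall>x\<in>U. \<forall>\<^sub>F (x', y) in uniformity. x' = x \<longrightarrow> y \<in> U)"

lemma ell2_nth_zero [simp]: "ell2_nth 0 j = 0"
  by (simp add: zero_ell2_def ell2_nth_ell2_of)

lemma ell2_nth_add [simp]: "ell2_nth (x + y) j = ell2_nth x j + ell2_nth y j"
  by (simp add: plus_ell2_def ell2_nth_ell2_of summable_square_add ell2_nth_summable)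

lemma ell2_nth_minus [simp]: "ell2_nth (- x) j = - ell2_nth x j"
  by (simp add: uminus_ell2_def ell2_nth_ell2_of ell2_nth_summable)

lemma ell2_nth_diff [simp]: "ell2_nth (x - y) j = ell2_nth x j - ell2_nth y j"
  using summable_square_add[OF ell2_nth_summable[of x], of "\<lambda>j. - ell2_nth y j"]
  by (simp add: minus_ell2_def ell2_nth_ell2_of ell2_nth_summable)

lemma ell2_nth_scaleR [simp]: "ell2_nth (r *\<^sub>R x) j = r * ell2_nth x j"
  by (simp add: scaleR_ell2_def ell2_nth_ell2_of summable_square_scale ell2_nth_summable)

lemma ell2_inner_summable: "summable (\<lambda>j. ell2_nth x j * ell2_nth y j)"
  by (intro summable_mult_of_squares ell2_nth_summable)

instance
proof
  fix x y z :: ell2 and r s :: real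
  show "x + y + z = x + (y + z)" "x + y = y + x" "0 + x = x" "- x + x = 0" "x - y = x + - y"
    by (auto intro!: ell2_eqI)
  show "r *\<^sub>R (x + y) = r *\<^sub>R x + r *\<^sub>R y" "(r + s) *\<^sub>R x = r *\<^sub>R x + s *\<^sub>R x"
    "r *\<^sub>R s *\<^sub>R x = (r * s) *\<^sub>R x" "1 *\<^sub>R x = x"
    by (auto intro!: ell2_eqI simp: algebra_simps)
  show "dist x y = norm (x - y)" "sgn x = inverse (norm x) *\<^sub>R x" "norm x = sqrt (inner x x)"
    "inner x y = inner y x"
    by (simp_all add: dist_ell2_def sgn_ell2_def norm_ell2_def inner_ell2_def mult.commute)
  show "uniformity = (INF e\<in>{0<..}. principal {(x :: ell2, y). dist x y < e})"
    by (rule uniformity_ell2_def)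
  show "open U \<longleftrightarrow> (\<forall>x\<in>U. \<forall>\<^sub>F (x', y) in uniformity. x' = x \<longrightarrow> y \<in> U)" for U :: "ell2 set"
    by (rule open_ell2_def)
  show "inner (x + y) z = inner x z + inner y z"
    by (simp add: inner_ell2_def distrib_right suminf_add ell2_inner_summable)
  show "inner (r *\<^sub>R x) y = r * inner x y"
    by (simp add: inner_ell2_def mult.assoc suminf_mult ell2_inner_summable)
  show "0 \<le> inner x x"
    by (simp add: inner_ell2_def suminf_nonneg ell2_inner_summable)
  show "inner x x = 0 \<longleftrightarrow> x = 0"
    using suminf_eq_zero_iff[OF ell2_inner_summable[of x x]]
    by (auto simp: inner_ell2_def intro!: ell2_eqI)
qed

end

lemma ell2_sum_le_norm: "(\<Sum>j<n. (ell2_nth x j)\<^sup>2) \<le> (norm x)\<^sup>2"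
proof -
  have "(norm x)\<^sup>2 = (\<Sum>j. (ell2_nth x j)\<^sup>2)"
    unfolding power2_norm_eq_inner inner_ell2_def by (simp add: power2_eq_square)
  then show ?thesis
    by (simp add: sum_le_suminf ell2_nth_summable)
qed

lemma ell2_nth_le_norm: "\<bar>ell2_nth x j\<bar> \<le> norm x"
proof -
  have "(ell2_nth x j)\<^sup>2 \<le> (\<Sum>i<Suc j. (ell2_nth x i)\<^sup>2)"
    by (simp add: sum_nonneg)
  also have "\<dots> \<le> (norm x)\<^sup>2"
    by (rule ell2_sum_le_norm)
  finally show ?thesis
    by (simp add: abs_le_square_iff[symmetric])
qed

instance ell2 :: banach
proof
  fix X :: "nat \<Rightarrow> ell2"
  assume X: "Cauchy X"
  have "Cauchy (\<lambda>k. ell2_nth (X k) j)" for j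
  proof (rule CauchyI)
    fix e :: real assume "0 < e"
    then obtain M where "\<forall>m\<ge>M. \<forall>n\<ge>M. norm (X m - X n) < e"
      using CauchyD[OF X] by blast
    moreover have "norm (ell2_nth (X m) j - ell2_nth (X n) j) \<le> norm (X m - X n)" for m n
      using ell2_nth_le_norm[of "X m - X n" j] by simp
    ultimately show "\<exists>M. \<forall>m\<ge>M. \<forall>n\<ge>M. norm (ell2_nth (X m) j - ell2_nth (X n) j) < e"
      by (meson le_less_trans)
  qed
  then have "\<forall>j. \<exists>l. (\<lambda>k. ell2_nth (X k) j) \<longlonglongrightarrow> l"
    by (simp add: Cauchy_convergent_iff convergent_def)
  then obtain a where a: "\<And>j. (\<lambda>k. ell2_nth (X k) j) \<longlonglongrightarrow> a j"
    by metis
  have tail: "\<exists>M. \<forall>m\<ge>M. \<forall>n. (\<Sum>j<n. (ell2_nth (X m) j - a j)\<^sup>2) \<le> e\<^sup>2" if "0 < e" for e :: real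
  proof -
    obtain M where M: "\<And>m n. m \<ge> M \<Longrightarrow> n \<ge> M \<Longrightarrow> norm (X m - X n) < e"
      using CauchyD[OF X \<open>0 < e\<close>] by blast
    have "(\<Sum>j<n. (ell2_nth (X m) j - a j)\<^sup>2) \<le> e\<^sup>2" if "m \<ge> M" for m n
    proof (rule LIMSEQ_le_const2)
      show "(\<lambda>k. \<Sum>j<n. (ell2_nth (X m) j - ell2_nth (X k) j)\<^sup>2)
          \<longlonglongrightarrow> (\<Sum>j<n. (ell2_nth (X m) j - a j)\<^sup>2)"
        by (intro tendsto_intros a)
      have "(\<Sum>j<n. (ell2_nth (X m) j - ell2_nth (X k) j)\<^sup>2) \<le> e\<^sup>2" if "k \<ge> M" for k
        using ell2_sum_le_norm[where x = "X m - X k" and n = n] M[OF \<open>m \<ge> M\<close> that]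
          power_mono[of "norm (X m - X k)" e 2]
        by simp
      then show "\<exists>N. \<forall>k\<ge>N. (\<Sum>j<n. (ell2_nth (X m) j - ell2_nth (X k) j)\<^sup>2) \<le> e\<^sup>2"
        by blast
    qed
    then show ?thesis by blast
  qed
  have summ: "summable (\<lambda>j. (ell2_nth (X m) j - a j)\<^sup>2)"
    if "\<forall>n. (\<Sum>j<n. (ell2_nth (X m) j - a j)\<^sup>2) \<le> e\<^sup>2" for m and e :: real
    using that by (intro summableI_nonneg_bounded) auto
  obtain M1 where "\<forall>n. (\<Sum>j<n. (ell2_nth (X M1) j - a j)\<^sup>2) \<le> 1\<^sup>2"
    using tail[of 1] by auto
  from summ[OF this] have "summable (\<lambda>j. (ell2_nth (X M1) j - a j)\<^sup>2)" .
  from summable_square_add[OF summable_square_scale[OF this, of "-1"] ell2_nth_summable[of "X M1"]]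
  have "summable (\<lambda>j. (a j)\<^sup>2)"
    by simp
  then have L: "ell2_nth (ell2_of a) = a"
    by (rule ell2_nth_ell2_of)
  have "X \<longlonglongrightarrow> ell2_of a"
  proof (rule LIMSEQ_I)
    fix e :: real assume "0 < e"
    then obtain M where M: "\<forall>m\<ge>M. \<forall>n. (\<Sum>j<n. (ell2_nth (X m) j - a j)\<^sup>2) \<le> (e / 2)\<^sup>2"
      using tail[of "e / 2"] by auto
    have "norm (X m - ell2_of a) < e" if "m \<ge> M" for m
    proof -
      have b: "\<forall>n. (\<Sum>j<n. (ell2_nth (X m) j - a j)\<^sup>2) \<le> (e / 2)\<^sup>2"
        using M that by blast
      have "(norm (X m - ell2_of a))\<^sup>2 = (\<Sum>j. (ell2_nth (X m) j - a j)\<^sup>2)"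
        unfolding power2_norm_eq_inner inner_ell2_def by (simp add: L power2_eq_square)
      also have "\<dots> \<le> (e / 2)\<^sup>2"
        using b by (intro suminf_le_const summ[OF b]) auto
      finally have "norm (X m - ell2_of a) \<le> e / 2"
        using \<open>0 < e\<close> by (auto intro: power2_le_imp_le)
      then show ?thesis using \<open>0 < e\<close> by simp
    qed
    then show "\<exists>M. \<forall>m\<ge>M. norm (X m - ell2_of a) < e"
      by blast
  qed
  then show "convergent X"
    by (rule convergentI)
qed


section \<open>Strongly continuous semigroups and stability\<close>

definition c0_semigroup :: "(real \<Rightarrow> 'a \<Rightarrow> 'a::banach) \<Rightarrow> bool" where
  "c0_semigroup T \<longleftrightarrow>
     (\<forall>t\<ge>0. bounded_linear (T t)) \<and>
     T 0 = id \<and>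
     (\<forall>s\<ge>0. \<forall>t\<ge>0. T (s + t) = T s \<circ> T t) \<and>
     (\<forall>x. ((\<lambda>t. T t x) \<longlongrightarrow> x) (at_right 0))"

text \<open>An unbounded operator is given by its domain \<open>D\<close> and a total function \<open>A\<close>, of which only
  the values on \<open>D\<close> matter.\<close>

definition is_generator :: "'a set \<Rightarrow> ('a \<Rightarrow> 'a) \<Rightarrow> (real \<Rightarrow> 'a \<Rightarrow> 'a::banach) \<Rightarrow> bool" where
  "is_generator D A T \<longleftrightarrow>
     D = {x. \<exists>y. ((\<lambda>h. (T h x - x) /\<^sub>R h) \<longlongrightarrow> y) (at_right 0)} \<and>
     (\<forall>x\<in>D. ((\<lambda>h. (T h x - x) /\<^sub>R h) \<longlongrightarrow> A x) (at_right 0))"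

text \<open>The semigroup \<open>e\<^sup>t\<^sup>A\<close> generated by \<open>(D, A)\<close>. A generator determines its semigroup at all
  times \<open>t \<ge> 0\<close>; the value is meaningful only for such \<open>t\<close>, and only if \<open>(D, A)\<close> is a generator.\<close>

definition generated_semigroup :: "'a set \<Rightarrow> ('a \<Rightarrow> 'a) \<Rightarrow> real \<Rightarrow> 'a \<Rightarrow> 'a::banach" where
  "generated_semigroup D A t x =
     (THE y. \<exists>T. c0_semigroup T \<and> is_generator D A T \<and> y = T t x)"

text \<open>Asymptotic stability of the zero solution, where \<open>S t e0\<close> is the value at time \<open>t\<close> of the
  solution starting at \<open>e0\<close>.\<close>

definition asymptotically_stable :: "(real \<Rightarrow> 'a \<Rightarrow> 'a::real_normed_vector) \<Rightarrow> bool" where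
  "asymptotically_stable S \<longleftrightarrow>
     (\<forall>\<epsilon>>0. \<exists>\<delta>>0. \<forall>e0. norm e0 < \<delta> \<longrightarrow> (\<forall>t\<ge>0. norm (S t e0) < \<epsilon>)) \<and>
     (\<forall>e0. ((\<lambda>t. S t e0) \<longlongrightarrow> 0) at_top)"


section \<open>The operators of the observer problem\<close>

text \<open>The library's inner product on pairs is the sum of the componentwise inner products.\<close>

type_synonym H = "ell2 \<times> ell2"

definition dom_A :: "(nat \<Rightarrow> real) \<Rightarrow> H set" where
  "dom_A \<omega> = {(\<xi>, \<eta>). summable (\<lambda>j. (\<omega> j)\<^sup>2 * ((ell2_nth \<xi> j)\<^sup>2 + (ell2_nth \<eta> j)\<^sup>2))}"

text \<open>On \<open>dom_A \<omega>\<close> the sequence \<open>\<omega> j * \<xi> j\<close> is square-summable for both components; elsewhere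
  the values of \<open>diag_op\<close> and \<open>op_A\<close> are irrelevant.\<close>

definition diag_op :: "(nat \<Rightarrow> real) \<Rightarrow> ell2 \<Rightarrow> ell2" where
  "diag_op \<omega> \<xi> = ell2_of (\<lambda>j. \<omega> j * ell2_nth \<xi> j)"

definition op_A :: "(nat \<Rightarrow> real) \<Rightarrow> H \<Rightarrow> H" where
  "op_A \<omega> = (\<lambda>(\<xi>, \<eta>). (diag_op \<omega> \<eta>, - diag_op \<omega> \<xi>))"

definition op_C :: "('r::finite \<Rightarrow> nat \<Rightarrow> real) \<Rightarrow> H \<Rightarrow> real ^ 'r" where
  "op_C c = (\<lambda>(\<xi>, \<eta>). \<chi> s. \<Sum>j. c s j * ell2_nth \<xi> j)"

text \<open>Used only for coefficients \<open>f\<close>, \<open>g\<close> whose columns are square-summable, so that \<open>ell2_of\<close> is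
  applied to square-summable sequences.\<close>

definition op_F ::
  "(nat \<Rightarrow> 'r::finite \<Rightarrow> real) \<Rightarrow> (nat \<Rightarrow> 'r \<Rightarrow> real) \<Rightarrow> real ^ 'r \<Rightarrow> H" where
  "op_F f g y = (ell2_of (\<lambda>j. \<Sum>s\<in>UNIV. f j s * y $ s), ell2_of (\<lambda>j. \<Sum>s\<in>UNIV. g j s * y $ s))"

end

theory Submission
  imports Defs
begin

text \<open>
  The operator \<open>A\<close> is skew and \<open>\<langle>F C e, e\<rangle> = \<Sum>\<^sub>s \<gamma>\<^sub>s y\<^sub>s\<^sup>2\<close> with \<open>y = C e\<close>, so the closed loop is
  dissipative and \<open>\<parallel>e(t)\<parallel>\<^sup>2\<close> is a Lyapunov function with derivative \<open>- 2 \<Sum>\<^sub>s \<gamma>\<^sub>s y\<^sub>s\<^sup>2\<close>; the output is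
  therefore square-integrable along every trajectory.  For each mode \<open>k\<close> there is a bounded quadratic
  functional whose derivative is \<open>- (c\<^sub>s\<^sub>k\<^sup>2 / 2) (\<xi>\<^sub>k\<^sup>2 + \<eta>\<^sub>k\<^sup>2)\<close> up to a term controlled by the output,
  which forces the energy of the mode to zero, since \<open>c\<^sub>s\<^sub>k \<noteq> 0\<close> for some \<open>s\<close>; this takes the place of
  the invariance principle.  For initial data in the domain \<open>A e(t)\<close> stays bounded, so
  the modes are dominated by a multiple of \<open>1 / \<omega>\<^sub>j\<close>, which is square-summable, and \<open>e(t) \<rightarrow> 0\<close> by
  dominated convergence; contractivity extends this to all initial data.

  The closed-loop semigroup itself is \<open>T t x = e\<^sup>t\<^sup>A v(t)\<close>, where \<open>v' = - e\<^sup>-\<^sup>t\<^sup>A F C e\<^sup>t\<^sup>A v\<close>, \<open>v(0) = x\<close>, is an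
  ordinary differential equation with bounded coefficients.
\<close>

section \<open>Semigroups and their generators\<close>

text \<open>Generators are defined by difference quotients, while orbits are differentiated as
  vector-valued functions; this links the two notions, for one-sided and two-sided neighbourhoods
  alike.\<close>

lemma has_vector_derivative_iff_quotient:
  fixes f :: "real \<Rightarrow> 'a::real_normed_vector"
  shows "(f has_vector_derivative d) (at x within S) \<longleftrightarrow>
    ((\<lambda>y. (f y - f x) /\<^sub>R (y - x)) \<longlongrightarrow> d) (at x within S)"
proof -
  have "norm ((1 / norm (y - x)) *\<^sub>R (f y - (f x + (y - x) *\<^sub>R d))) = norm ((f y - f x) /\<^sub>R (y - x) - d)"
    if "y \<noteq> x" for y
  proof -
    have "(f y - f x) /\<^sub>R (y - x) - d = (1 / (y - x)) *\<^sub>R (f y - (f x + (y - x) *\<^sub>R d))"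
      using that by (simp add: diff_diff_eq[symmetric] scaleR_diff_right[of _ "f y - f x"] inverse_eq_divide)
    then show ?thesis by simp
  qed
  then have "((\<lambda>y. norm ((1 / norm (y - x)) *\<^sub>R (f y - (f x + (y - x) *\<^sub>R d)))) \<longlongrightarrow> 0) (at x within S)
    \<longleftrightarrow> ((\<lambda>y. norm ((f y - f x) /\<^sub>R (y - x) - d)) \<longlongrightarrow> 0) (at x within S)"
    by (intro filterlim_cong refl) (auto simp: eventually_at_filter)
  then show ?thesis
    unfolding has_vector_derivative_def has_derivative_within
    by (simp only: tendsto_norm_zero_iff LIM_zero_iff bounded_linear_scaleR_left simp_thms)
qed

lemma has_real_derivative_inner:
  assumes "(f has_vector_derivative f') (at x within S)" "(g has_vector_derivative g') (at x within S)"
  shows "((\<lambda>x. inner (f x) (g x)) has_real_derivative inner (f x) g' + inner f' (g x)) (at x within S)"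
  using bounded_bilinear.has_vector_derivative[OF bounded_bilinear_inner assms]
  by (simp add: has_real_derivative_iff_has_vector_derivative)

text \<open>By Baire one of the closed sets \<open>E n\<close>, which exhaust the space, contains a
  ball. Subtracting its centre moves the bound to vectors of norm \<open>e\<close>, at the price of
  a factor 2, and homogeneity does the rest.\<close>

lemma uniform_boundedness:
  fixes T :: "'i \<Rightarrow> 'a::banach \<Rightarrow> 'b::real_normed_vector"
  assumes lin: "\<And>i. i \<in> I \<Longrightarrow> bounded_linear (T i)"
    and bdd: "\<And>x. \<exists>c. \<forall>i\<in>I. norm (T i x) \<le> c"
  shows "\<exists>M. \<forall>i\<in>I. \<forall>x. norm (T i x) \<le> M * norm x"
proof -
  define E where "E n = {x. \<forall>i\<in>I. norm (T i x) \<le> real n}" for n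
  have closed: "closed (E n)" for n
  proof -
    have "E n = (\<Inter>i\<in>I. {x. norm (T i x) \<le> real n})"
      by (auto simp: E_def)
    moreover have "closed {x. norm (T i x) \<le> real n}" if "i \<in> I" for i
      by (intro closed_Collect_le continuous_intros linear_continuous_on lin that)
    ultimately show ?thesis by auto
  qed
  have "\<exists>n. interior (E n) \<noteq> {}"
  proof (rule ccontr)
    assume "\<not> ?thesis"
    then have "euclidean interior_of \<Union>(range E) = {}"
      by (intro Baire_category_alt)
        (auto simp: completely_metrizable_space_euclidean closed
          simp flip: closed_closedin)
    moreover have "\<Union>(range E) = UNIV"
    proof -
      have "\<exists>n. x \<in> E n" for x
      proof -
        obtain c where c: "\<forall>i\<in>I. norm (T i x) \<le> c" using bdd by blast
        obtain n where "c \<le> real n" using real_arch_simple by blast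
        with c have "x \<in> E n" by (force simp: E_def)
        then show ?thesis ..
      qed
      then show ?thesis by blast
    qed
    ultimately show False by simp
  qed
  then obtain n z where "z \<in> interior (E n)" by blast
  then obtain e where e: "0 < e" "cball z e \<subseteq> E n"
    by (meson mem_interior_cball)
  have "norm (T i x) \<le> 2 * n / e * norm x" if i: "i \<in> I" for i x
  proof (cases "x = 0")
    case False
    interpret bounded_linear "T i" by (rule lin[OF i])
    define y where "y = (e / norm x) *\<^sub>R x"
    have "norm y = e" using False e by (simp add: y_def)
    then have "z + y \<in> E n" "z \<in> E n"
      using e by (auto simp: subset_iff dist_norm)
    then have "norm (T i (z + y)) \<le> n" "norm (T i z) \<le> n"
      using i by (auto simp: E_def)
    then have "norm (T i y) \<le> 2 * n"
      using norm_triangle_ineq4[of "T i (z + y)" "T i z"] by (simp add: add)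
    moreover have "norm (T i y) = e / norm x * norm (T i x)"
      using e by (simp add: y_def scaleR)
    ultimately show ?thesis using e False by (simp add: field_simps)
  next
    case True
    then show ?thesis by (simp add: bounded_linear.linear linear_0 lin i)
  qed
  then show ?thesis by blast
qed

section \<open>Local boundedness and strong continuity of semigroups\<close>

context
  fixes T :: "real \<Rightarrow> 'a \<Rightarrow> 'a::banach"
  assumes T: "c0_semigroup T"
begin

lemma c0_bounded_linear: "0 \<le> t \<Longrightarrow> bounded_linear (T t)"
  and c0_zero: "T 0 x = x"
  and c0_add: "0 \<le> s \<Longrightarrow> 0 \<le> t \<Longrightarrow> T (s + t) x = T s (T t x)"
  and c0_at_right: "((\<lambda>t. T t x) \<longlongrightarrow> x) (at_right 0)"
  using T by (auto simp: c0_semigroup_def)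

lemma c0_commute: "0 \<le> s \<Longrightarrow> 0 \<le> t \<Longrightarrow> T s (T t x) = T t (T s x)"
  by (metis c0_add add.commute)

text \<open>Otherwise there are times \<open>h n\<close> tending to 0 at which the operator norm
  exceeds \<open>n\<close>. Strong continuity at 0 makes each \<open>T (h n) x\<close> convergent,
  hence bounded, against the uniform boundedness principle.\<close>

lemma c0_bounded_near_0:
  obtains d M where "0 < d" "0 \<le> M" "\<And>h x. 0 \<le> h \<Longrightarrow> h \<le> d \<Longrightarrow> norm (T h x) \<le> M * norm x"
proof -
  have "\<exists>d>0. \<exists>M\<ge>0. \<forall>h\<in>{0..d}. \<forall>x. norm (T h x) \<le> M * norm x"
  proof (rule ccontr)
    assume contra: "\<not> ?thesis"
    have "\<exists>h\<in>{0..1 / real (Suc n)}. \<exists>x. norm (T h x) > real n * norm x" for n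
    proof (rule ccontr)
      assume "\<not> ?thesis"
      then have "\<forall>h\<in>{0..1 / real (Suc n)}. \<forall>x. norm (T h x) \<le> real n * norm x"
        by (simp add: not_less)
      moreover have "0 < 1 / real (Suc n)" "0 \<le> real n" by auto
      ultimately show False using contra by blast
    qed
    then obtain h where h: "\<And>n. 0 \<le> h n" "\<And>n. h n \<le> 1 / real (Suc n)"
      and big: "\<And>n. \<exists>x. norm (T (h n) x) > real n * norm x"
      by (metis atLeastAtMost_iff)
    have "h \<longlonglongrightarrow> 0"
    proof (rule tendsto_sandwich)
      show "\<forall>\<^sub>F n in sequentially. 0 \<le> h n" "\<forall>\<^sub>F n in sequentially. h n \<le> 1 / real (Suc n)"
        using h by auto
      show "(\<lambda>n. 1 / real (Suc n)) \<longlonglongrightarrow> 0"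
        using LIMSEQ_inverse_real_of_nat by (simp add: inverse_eq_divide)
    qed simp
    have "\<exists>c. \<forall>n\<in>UNIV. norm (T (h n) x) \<le> c" for x
    proof -
      have "((\<lambda>t. T t x) \<longlongrightarrow> T 0 x) (at 0 within {0..})"
        using c0_at_right[of x] by (simp add: c0_zero at_within_Ici_at_right)
      then have "continuous (at 0 within {0..}) (\<lambda>t. T t x)"
        by (simp add: continuous_within)
      then have "(\<lambda>n. T (h n) x) \<longlonglongrightarrow> T 0 x"
        using \<open>h \<longlonglongrightarrow> 0\<close> h by (simp add: continuous_within_sequentially o_def)
      then have "bounded (range (\<lambda>n. T (h n) x))"
        by (rule convergent_imp_bounded)
      then show ?thesis by (auto simp: bounded_iff)
    qed
    then obtain M where M: "\<And>n x. norm (T (h n) x) \<le> M * norm x"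
      using uniform_boundedness[of UNIV "\<lambda>n. T (h n)"] c0_bounded_linear h by blast
    obtain n where "M \<le> real n" using real_arch_simple by blast
    then have "norm (T (h n) x) \<le> real n * norm x" for x
      using M[of n x] by (meson dual_order.trans mult_right_mono norm_ge_zero)
    with big[of n] show False by (auto simp: not_less[symmetric])
  qed
  then show thesis using that by force
qed

text \<open>Factor \<open>T (t - h) = T (t - d') T (d' - h)\<close>: the first operator is fixed and
  the second has its time in the range of \<open>c0_bounded_near_0\<close>.\<close>

lemma c0_bounded_left:
  assumes "0 < t"
  obtains d M where "0 < d" "d \<le> t" "0 \<le> M"
    "\<And>h x. 0 \<le> h \<Longrightarrow> h \<le> d \<Longrightarrow> norm (T (t - h) x) \<le> M * norm x"
proof -
  obtain d M where d: "0 < d" "0 \<le> M" and M: "\<And>h x. 0 \<le> h \<Longrightarrow> h \<le> d \<Longrightarrow> norm (T h x) \<le> M * norm x"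
    using c0_bounded_near_0 by blast
  define d' where "d' = min d t"
  have d': "0 < d'" "d' \<le> d" "d' \<le> t" using d assms by (auto simp: d'_def)
  obtain B where B: "0 \<le> B" "\<And>x. norm (T (t - d') x) \<le> B * norm x"
    using bounded_linear.nonneg_bounded[OF c0_bounded_linear[of "t - d'"]] d'
    by (metis diff_ge_0_iff_ge mult.commute)
  show thesis
  proof (rule that[of d' "B * M"])
    fix h x assume h: "0 \<le> h" "h \<le> d'"
    have "T (t - h) x = T (t - d') (T (d' - h) x)"
      using c0_add[of "t - d'" "d' - h" x] h d' by simp
    then have "norm (T (t - h) x) \<le> B * norm (T (d' - h) x)"
      using B by simp
    also have "\<dots> \<le> B * (M * norm x)"
      using M[of "d' - h" x] h d' B by (intro mult_left_mono) auto
    finally show "norm (T (t - h) x) \<le> B * M * norm x" by simp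
  qed (use d' d B in auto)
qed

lemma c0_right_limit:
  assumes "0 \<le> t" "(f \<longlongrightarrow> y) F"
  shows "((\<lambda>h. T t (f h)) \<longlongrightarrow> T t y) F"
  by (rule bounded_linear.tendsto[OF c0_bounded_linear[OF assms(1)] assms(2)])

text \<open>Time and argument vary together. Replacing \<open>f h\<close> by \<open>T h y\<close>
  makes the value constantly \<open>T t y\<close>, and the error \<open>f h - T h y\<close> tends to
  0 under uniformly bounded operators.\<close>

lemma c0_left_limit:
  assumes t: "0 < t" and f: "(f \<longlongrightarrow> y) (at_right 0)"
  shows "((\<lambda>h. T (t - h) (f h)) \<longlongrightarrow> T t y) (at_right 0)"
proof -
  obtain d M where d: "0 < d" "d \<le> t" "0 \<le> M"
    and M: "\<And>h x. 0 \<le> h \<Longrightarrow> h \<le> d \<Longrightarrow> norm (T (t - h) x) \<le> M * norm x"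
    using c0_bounded_left[OF t] by blast
  have "((\<lambda>h. T (t - h) (f h - T h y)) \<longlongrightarrow> 0) (at_right 0)"
  proof (rule Lim_null_comparison)
    show "\<forall>\<^sub>F h in at_right 0. norm (T (t - h) (f h - T h y)) \<le> M * norm (f h - T h y)"
      unfolding eventually_at_right_field using d M by (metis less_imp_le)
    have "((\<lambda>h. M * norm (f h - T h y)) \<longlongrightarrow> M * norm (y - y)) (at_right 0)"
      by (intro tendsto_intros f c0_at_right)
    then show "((\<lambda>h. M * norm (f h - T h y)) \<longlongrightarrow> 0) (at_right 0)" by simp
  qed
  then have "((\<lambda>h. T (t - h) (f h - T h y) + T t y) \<longlongrightarrow> T t y) (at_right 0)"
    using tendsto_add[OF _ tendsto_const, of _ 0 _ "T t y"] by simp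
  moreover have "\<forall>\<^sub>F h in at_right 0. T (t - h) (f h - T h y) + T t y = T (t - h) (f h)"
    unfolding eventually_at_right_field
  proof (intro exI[of _ t] conjI t allI impI)
    fix h assume h: "0 < h" "h < t"
    then have "linear (T (t - h))" by (simp add: bounded_linear.linear c0_bounded_linear)
    moreover have "T (t - h) (T h y) = T t y" using c0_add[of "t - h" h y] h by simp
    ultimately show "T (t - h) (f h - T h y) + T t y = T (t - h) (f h)"
      by (simp add: linear_diff)
  qed
  ultimately show ?thesis
    by (rule Lim_transform_eventually)
qed

text \<open>Only right continuity at 0 is assumed. To the right of \<open>t\<close> it is
  transported by \<open>T t\<close>; to the left it is \<open>c0_left_limit\<close> with a constant
  function.\<close>

lemma c0_continuous_on: "continuous_on {0..} (\<lambda>t. T t x)"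
  unfolding continuous_on_def
proof (intro ballI)
  fix t :: real assume t: "t \<in> {0..}"
  have right: "((\<lambda>t. T t x) \<longlongrightarrow> T t x) (at_right t)"
  proof -
    have "((\<lambda>h. T t (T h x)) \<longlongrightarrow> T t x) (at_right 0)"
      using t by (intro c0_right_limit c0_at_right) auto
    moreover have "\<forall>\<^sub>F h in at_right 0. T t (T h x) = T (h + t) x"
      using t by (auto simp: eventually_at_filter c0_add add.commute[of _ t])
    ultimately show ?thesis
      unfolding filterlim_at_right_to_0[of _ _ t] by (rule Lim_transform_eventually)
  qed
  show "((\<lambda>t. T t x) \<longlongrightarrow> T t x) (at t within {0..})"
  proof (cases "t = 0")
    case True
    then show ?thesis using right by (simp add: at_within_Ici_at_right)
  next
    case False
    then have "0 < t" using t by auto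
    then have "((\<lambda>h. T (t - h) x) \<longlongrightarrow> T t x) (at_right 0)"
      by (rule c0_left_limit) simp
    then have "((\<lambda>t. T t x) \<longlongrightarrow> T t x) (at_left t)"
      unfolding filterlim_at_left_to_right filterlim_at_right_to_0[of _ _ "-t"]
      by (simp add: add.commute[of _ "-t"])
    then have "((\<lambda>t. T t x) \<longlongrightarrow> T t x) (at t)"
      using right by (simp add: filterlim_split_at)
    then show ?thesis by (rule tendsto_within_subset) simp
  qed
qed

section \<open>Orbits starting in the domain of the generator\<close>

context
  fixes D :: "'a set" and A :: "'a \<Rightarrow> 'a"
  assumes gen: "is_generator D A T"
begin

lemma generator_limit: "x \<in> D \<Longrightarrow> ((\<lambda>h. (T h x - x) /\<^sub>R h) \<longlongrightarrow> A x) (at_right 0)"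
  using gen by (auto simp: is_generator_def)

text \<open>\<open>T t\<close> is bounded and commutes with the difference quotients, so it carries
  their limit along.\<close>

lemma generator_orbit:
  assumes x: "x \<in> D" and t: "0 \<le> t"
  shows "T t x \<in> D" "A (T t x) = T t (A x)"
proof -
  have lim: "((\<lambda>h. T t ((T h x - x) /\<^sub>R h)) \<longlongrightarrow> T t (A x)) (at_right 0)"
    by (intro c0_right_limit t generator_limit x)
  have "linear (T t)" using t by (simp add: bounded_linear.linear c0_bounded_linear)
  then have "\<forall>\<^sub>F h in at_right 0. T t ((T h x - x) /\<^sub>R h) = (T h (T t x) - T t x) /\<^sub>R h"
    by (auto simp: eventually_at_filter linear_diff linear_scale c0_commute[OF t])
  then have *: "((\<lambda>h. (T h (T t x) - T t x) /\<^sub>R h) \<longlongrightarrow> T t (A x)) (at_right 0)"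
    by (rule Lim_transform_eventually[OF lim])
  then show D: "T t x \<in> D" using gen by (auto simp: is_generator_def)
  show "A (T t x) = T t (A x)"
    by (rule tendsto_unique[OF _ generator_limit[OF D] *]) simp
qed

text \<open>The right quotient is the generator's quotient at \<open>T t x\<close>. The left one is
  \<open>T (t - h)\<close> applied to the quotient at \<open>x\<close>, a case of
  \<open>c0_left_limit\<close>.\<close>

lemma generator_orbit_derivative:
  assumes x: "x \<in> D" and t: "0 < t"
  shows "((\<lambda>t. T t x) has_vector_derivative A (T t x)) (at t)"
  unfolding has_vector_derivative_iff_quotient
proof (rule filterlim_split_at)
  have t0: "0 \<le> t" using t by simp
  have "((\<lambda>h. (T h (T t x) - T t x) /\<^sub>R h) \<longlongrightarrow> A (T t x)) (at_right 0)"
    by (intro generator_limit generator_orbit x t0)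
  moreover have "\<forall>\<^sub>F h in at_right 0. (T h (T t x) - T t x) /\<^sub>R h = (T (h + t) x - T t x) /\<^sub>R (h + t - t)"
    using t0 by (auto simp: eventually_at_filter c0_add)
  ultimately show "((\<lambda>y. (T y x - T t x) /\<^sub>R (y - t)) \<longlongrightarrow> A (T t x)) (at_right t)"
    unfolding filterlim_at_right_to_0[of _ _ t] by (rule Lim_transform_eventually)
  have "((\<lambda>h. T (t - h) ((T h x - x) /\<^sub>R h)) \<longlongrightarrow> A (T t x)) (at_right 0)"
    unfolding generator_orbit(2)[OF x t0] by (intro c0_left_limit t generator_limit x)
  moreover have "\<forall>\<^sub>F h in at_right 0. T (t - h) ((T h x - x) /\<^sub>R h)
      = (T (- (h + - t)) x - T t x) /\<^sub>R (- (h + - t) - t)"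
    unfolding eventually_at_right_field
  proof (intro exI[of _ t] conjI t allI impI)
    fix h assume h: "0 < h" "h < t"
    then have "linear (T (t - h))" by (simp add: bounded_linear.linear c0_bounded_linear)
    moreover have "T (t - h) (T h x) = T t x" using c0_add[of "t - h" h x] h by simp
    ultimately show "T (t - h) ((T h x - x) /\<^sub>R h) = (T (- (h + - t)) x - T t x) /\<^sub>R (- (h + - t) - t)"
      by (simp add: linear_diff linear_scale algebra_simps)
  qed
  ultimately show "((\<lambda>y. (T y x - T t x) /\<^sub>R (y - t)) \<longlongrightarrow> A (T t x)) (at_left t)"
    unfolding filterlim_at_left_to_right filterlim_at_right_to_0[of _ _ "-t"]
    by (rule Lim_transform_eventually)
qed

end

end

lemma dissipative_contraction:
  fixes T S :: "real \<Rightarrow> 'a \<Rightarrow> 'a::{banach, real_inner}"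
  assumes T: "c0_semigroup T" "is_generator D A T" and S: "c0_semigroup S" "is_generator D A S"
    and diss: "\<And>x y. x \<in> D \<Longrightarrow> y \<in> D \<Longrightarrow> inner (A x - A y) (x - y) \<le> 0"
    and dense: "closure D = UNIV" and t: "0 \<le> t"
  shows "norm (T t x - S t y) \<le> norm (x - y)"
proof -
  have on_D: "norm (T t x - S t y) \<le> norm (x - y)" if "x \<in> D" "y \<in> D" for x y
  proof -
    let ?d = "\<lambda>s. T s x - S s y"
    have "(norm (?d t))\<^sup>2 \<le> (norm (?d 0))\<^sup>2"
    proof (rule DERIV_nonpos_imp_decreasing_open[OF t])
      fix s :: real assume s: "0 < s" "s < t"
      then have d: "(?d has_vector_derivative A (T s x) - A (S s y)) (at s)"
        using that by (intro has_vector_derivative_diff generator_orbit_derivative[OF T]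
            generator_orbit_derivative[OF S]) auto
      have "((\<lambda>s. inner (?d s) (?d s)) has_real_derivative 2 * inner (A (T s x) - A (S s y)) (?d s)) (at s)"
        using has_real_derivative_inner[OF d d] by (simp add: inner_commute flip: mult_2)
      moreover have "inner (A (T s x) - A (S s y)) (?d s) \<le> 0"
        using s that by (intro diss generator_orbit[OF T] generator_orbit[OF S]) auto
      ultimately show "\<exists>y'. ((\<lambda>s. (norm (?d s))\<^sup>2) has_real_derivative y') (at s) \<and> y' \<le> 0"
        by (auto simp: power2_norm_eq_inner)
    next
      show "continuous_on {0..t} (\<lambda>s. (norm (?d s))\<^sup>2)"
        by (intro continuous_intros continuous_on_subset[OF c0_continuous_on[OF T(1)]]
            continuous_on_subset[OF c0_continuous_on[OF S(1)]]) auto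
    qed
    then have "norm (?d t) \<le> norm (?d 0)" by (rule power2_le_imp_le) simp
    then show ?thesis by (simp add: c0_zero[OF T(1)] c0_zero[OF S(1)])
  qed
  have approx: "\<exists>f. (\<forall>n. f n \<in> D) \<and> f \<longlonglongrightarrow> z" for z
    using dense by (simp flip: closure_sequential)
  obtain f where f: "\<And>n. f n \<in> D" "f \<longlonglongrightarrow> x" using approx by blast
  obtain g where g: "\<And>n. g n \<in> D" "g \<longlonglongrightarrow> y" using approx by blast
  show ?thesis
  proof (rule LIMSEQ_le)
    show "(\<lambda>n. norm (f n - g n)) \<longlonglongrightarrow> norm (x - y)"
      by (intro tendsto_intros f g)
    show "(\<lambda>n. norm (T t (f n) - S t (g n))) \<longlonglongrightarrow> norm (T t x - S t y)"
      by (intro tendsto_intros c0_right_limit[OF T(1) t] c0_right_limit[OF S(1) t] f g)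
    show "\<exists>N. \<forall>n\<ge>N. norm (T t (f n) - S t (g n)) \<le> norm (f n - g n)"
      using on_D f g by blast
  qed
qed

text \<open>Uniqueness from \<open>dissipative_contraction\<close> makes the definite description in
  \<open>generated_semigroup\<close> well defined.\<close>

lemma generated_semigroup_eq:
  fixes T :: "real \<Rightarrow> 'a \<Rightarrow> 'a::{banach, real_inner}"
  assumes T: "c0_semigroup T" "is_generator D A T"
    and diss: "\<And>x y. x \<in> D \<Longrightarrow> y \<in> D \<Longrightarrow> inner (A x - A y) (x - y) \<le> 0"
    and dense: "closure D = UNIV" and t: "0 \<le> t"
  shows "generated_semigroup D A t x = T t x"
  unfolding generated_semigroup_def
proof (rule the_equality)
  show "\<exists>T'. c0_semigroup T' \<and> is_generator D A T' \<and> T t x = T' t x" using T by blast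
  fix y assume "\<exists>T'. c0_semigroup T' \<and> is_generator D A T' \<and> y = T' t x"
  then obtain S where S: "c0_semigroup S" "is_generator D A S" and y: "y = S t x" by blast
  have "norm (S t x - T t x) \<le> norm (x - x)"
    by (rule dissipative_contraction[OF S T diss dense t])
  then show "y = T t x" by (simp add: y)
qed

section \<open>Bounded perturbations of isometry groups\<close>

lemma has_vector_derivative_integral_atLeast:
  fixes f :: "real \<Rightarrow> 'a::banach"
  assumes f: "continuous_on {0..} f" and t: "0 \<le> t"
  shows "((\<lambda>t. integral {0..t} f) has_vector_derivative f t) (at t within {0..})"
proof -
  have "((\<lambda>t. integral {0..t} f) has_vector_derivative f t) (at t within {0..t + 1})"
    using t by (intro integral_has_vector_derivative continuous_on_subset[OF f]) auto
  moreover have "at t within {0..t + 1} = at t within {0..}"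
    by (rule at_within_nhd[of _ "{..<t + 1}"]) (use t in auto)
  ultimately show ?thesis by simp
qed

lemma has_vector_derivative_shift: "((+) s has_vector_derivative 1) (at t within S)" for s :: real
  using has_vector_derivative_add[OF has_vector_derivative_const has_vector_derivative_id] by simp

text \<open>Banach's fixed point theorem in the bounded continuous functions, for the rescaled
  unknown \<open>w t = exp (- l * t) *\<^sub>R v t\<close>. Continuity is required only along
  continuous functions because \<open>G\<close> will be merely strongly continuous in time.\<close>

lemma linear_ode_exists:
  fixes G :: "real \<Rightarrow> 'a \<Rightarrow> 'a::banach"
  assumes lin: "\<And>t. linear (G t)" and bound: "\<And>t x. norm (G t x) \<le> k * norm x" and k: "0 \<le> k"
    and cont: "\<And>w. continuous_on {0..} w \<Longrightarrow> continuous_on {0..} (\<lambda>t. G t (w t))"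
  shows "\<exists>v. v 0 = x \<and> (\<forall>t\<ge>0. (v has_vector_derivative G t (v t)) (at t within {0..}))"
proof -
  \<comment> \<open>\<open>2 * k\<close> gives the contraction factor 1/2; the summand 1 keeps
    \<open>l\<close> positive when \<open>k = 0\<close>.\<close>
  define l where "l = 2 * k + 1"
  have l: "0 < l" "k / l \<le> 1 / 2" using k by (auto simp: l_def field_simps)
  define f where "f w s = exp (l * s) *\<^sub>R G s (w s)" for w s
  define J where "J w t = integral {0..t} (f w)" for w t
  have cont_f: "continuous_on {0..} (f w)" if "continuous_on UNIV w" for w
    unfolding f_def by (intro continuous_intros cont continuous_on_subset[OF that]) auto
  have int_f: "f w integrable_on {0..t}" if "continuous_on UNIV w" for w t
    by (intro integrable_continuous_real continuous_on_subset[OF cont_f[OF that]]) auto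
  have J_deriv: "(J w has_vector_derivative f w t) (at t within {0..})"
    if "continuous_on UNIV w" "0 \<le> t" for w t
    unfolding J_def[abs_def] by (intro has_vector_derivative_integral_atLeast cont_f that)
  have J_bound: "norm (J w t) \<le> B / 2 * exp (l * t)"
    if w: "continuous_on UNIV w" and B: "\<And>s. norm (w s) \<le> B" and t: "0 \<le> t" for w B t
  proof -
    have B0: "0 \<le> B" using B[of 0] norm_ge_zero by (rule order_trans[rotated])
    have I: "((\<lambda>s. k * B * exp (l * s)) has_integral k * B / l * exp (l * t) - k * B / l * exp (l * 0)) {0..t}"
      using l by (intro fundamental_theorem_of_calculus t)
        (auto intro!: derivative_eq_intros simp flip: has_real_derivative_iff_has_vector_derivative)
    have "norm (J w t) \<le> integral {0..t} (\<lambda>s. k * B * exp (l * s))"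
      unfolding J_def
    proof (rule integral_norm_bound_integral[OF int_f[OF w]])
      show "(\<lambda>s. k * B * exp (l * s)) integrable_on {0..t}" using I by blast
      fix s
      have "norm (G s (w s)) \<le> k * B"
        using bound[of s "w s"] mult_left_mono[OF B k] by (rule order_trans)
      then show "norm (f w s) \<le> k * B * exp (l * s)"
        by (simp add: f_def mult.commute)
    qed
    also have "\<dots> = k / l * (B * (exp (l * t) - 1))"
      by (subst integral_unique[OF I]) (simp add: algebra_simps)
    also have "\<dots> \<le> 1 / 2 * (B * exp (l * t))"
      using l B0 k t by (intro mult_mono) auto
    finally show ?thesis by simp
  qed
  \<comment> \<open>The fixed-point space consists of functions on the whole line;
    \<open>max 0 t\<close> continues the image by the constant \<open>x\<close> to negative
    times.\<close>
  define P where "P w t = exp (- l * max 0 t) *\<^sub>R (x + J w (max 0 t))" for w t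
  have cont_P: "continuous_on UNIV (P w)" if "continuous_on UNIV w" for w
  proof -
    have "continuous_on {0..} (J w)"
      using J_deriv[OF that] by (intro continuous_on_vector_derivative) auto
    then have "continuous_on UNIV (\<lambda>t. J w (max 0 t))"
      by (rule continuous_on_compose2) (auto intro!: continuous_intros)
    then show ?thesis unfolding P_def[abs_def] by (intro continuous_intros)
  qed
  have P_bound: "norm (P w t) \<le> norm x + B / 2" if "continuous_on UNIV w" "\<And>s. norm (w s) \<le> B" for w B t
  proof -
    let ?m = "max 0 t"
    have "norm (x + J w ?m) \<le> norm x + B / 2 * exp (l * ?m)"
      using norm_triangle_ineq[of x "J w ?m"] J_bound[OF that, of ?m] by simp
    then have "exp (- l * ?m) * norm (x + J w ?m) \<le> exp (- l * ?m) * (norm x + B / 2 * exp (l * ?m))"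
      by (rule mult_left_mono) simp
    also have "\<dots> = exp (- l * ?m) * norm x + B / 2"
      by (simp add: distrib_left exp_minus)
    also have "\<dots> \<le> 1 * norm x + B / 2"
      using l by (intro add_mono mult_right_mono) auto
    finally show ?thesis by (simp add: P_def)
  qed
  \<comment> \<open>The weight \<open>exp (- l * t)\<close> makes the Picard map a contraction on all of \<open>{0..}\<close> at once.\<close>
  define F where "F w = Bcontfun (P (apply_bcontfun w))" for w :: "real \<Rightarrow>\<^sub>C 'a"
  have F: "apply_bcontfun (F w) = P (apply_bcontfun w)" for w
    unfolding F_def
    by (intro Bcontfun_inverse bcontfun_normI[where b="norm x + norm w / 2"] cont_P P_bound norm_bounded) auto
  have "dist (F w1) (F w2) \<le> 1 / 2 * dist w1 w2" for w1 w2
  proof (rule dist_bound)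
    fix t :: real
    let ?m = "max 0 t" and ?d = "\<lambda>s. apply_bcontfun w1 s - apply_bcontfun w2 s"
    have "f w1 s - f w2 s = f ?d s" for s
      by (simp add: f_def linear_diff[OF lin] scaleR_diff_right)
    then have "J w1 ?m - J w2 ?m = J ?d ?m"
      unfolding J_def by (subst integral_diff[symmetric]) (auto intro!: int_f)
    then have "P w1 t - P w2 t = exp (- l * ?m) *\<^sub>R J ?d ?m"
      by (simp add: P_def flip: scaleR_diff_right)
    then have "norm (P w1 t - P w2 t) = exp (- l * ?m) * norm (J ?d ?m)"
      by simp
    also have "\<dots> \<le> exp (- l * ?m) * (dist w1 w2 / 2 * exp (l * ?m))"
      by (intro mult_left_mono J_bound continuous_intros)
        (auto simp: dist_norm[symmetric] dist_bounded)
    also have "\<dots> = 1 / 2 * dist w1 w2" by (simp add: exp_minus)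
    finally show "dist (apply_bcontfun (F w1) t) (apply_bcontfun (F w2) t) \<le> 1 / 2 * dist w1 w2"
      by (simp add: F dist_norm)
  qed
  then obtain w where w: "F w = w"
    using banach_fix_type[of "1 / 2" F] by auto
  define v where "v t = x + J w t" for t
  have v: "v t = exp (l * t) *\<^sub>R apply_bcontfun w t" if "0 \<le> t" for t
  proof -
    have "apply_bcontfun w t = exp (- l * t) *\<^sub>R v t"
      using fun_cong[OF F[of w], of t] that by (simp add: w P_def[of _ t] v_def)
    then show ?thesis by (simp add: exp_minus)
  qed
  have "(v has_vector_derivative G t (v t)) (at t within {0..})" if t: "0 \<le> t" for t
  proof -
    have "(v has_vector_derivative 0 + f w t) (at t within {0..})"
      unfolding v_def[abs_def]
      by (intro has_vector_derivative_add has_vector_derivative_const J_deriv t) simp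
    then show ?thesis by (simp add: f_def v[OF t] linear_scale[OF lin])
  qed
  moreover have "v 0 = x" by (simp add: v_def J_def)
  ultimately show ?thesis by blast
qed

section \<open>Strongly continuous groups of isometries\<close>

locale isometry_group =
  fixes U :: "real \<Rightarrow> 'a \<Rightarrow> 'a::{banach, real_inner}"
  assumes U_linear: "linear (U t)"
    and U_norm [simp]: "norm (U t x) = norm x"
    and U_zero [simp]: "U 0 x = x"
    and U_add: "U (s + t) x = U s (U t x)"
    and U_cont: "continuous_on UNIV (\<lambda>t. U t x)"
begin

lemma U_minus [simp]: "U (- t) (U t x) = x"
  by (simp flip: U_add)

text \<open>Polarisation: a linear isometry preserves inner products, so the adjoint of
  \<open>U (- t)\<close> is its inverse.\<close>

lemma U_inner: "inner (U (- t) x) y = inner x (U t y)"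
proof -
  have "inner (U t a) (U t b) = inner a b" for a b
    by (simp add: dot_norm flip: linear_add[OF U_linear])
  then show ?thesis by (metis U_minus minus_minus)
qed

lemma U_bounded_linear: "bounded_linear (U t)"
  by (rule bounded_linear_intro[where K=1])
     (auto simp: linear_add[OF U_linear] linear_scale[OF U_linear])

text \<open>Isometries keep the error \<open>w i - y\<close> small whatever the time, and strong
  continuity deals with \<open>U (g i) y\<close>.\<close>

lemma U_tendsto:
  assumes g: "(g \<longlongrightarrow> t) F" and w: "(w \<longlongrightarrow> y) F"
  shows "((\<lambda>i. U (g i) (w i)) \<longlongrightarrow> U t y) F"
proof -
  have "((\<lambda>i. U (g i) (w i - y)) \<longlongrightarrow> 0) F"
    by (rule tendsto_norm_zero_cancel) (use LIM_zero[OF w] in \<open>simp add: tendsto_norm_zero_iff\<close>)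
  moreover have "((\<lambda>i. U (g i) y) \<longlongrightarrow> U t y) F"
    by (rule continuous_on_tendsto_compose[OF U_cont g]) auto
  ultimately have "((\<lambda>i. U (g i) (w i - y) + U (g i) y) \<longlongrightarrow> 0 + U t y) F"
    by (rule tendsto_add)
  then show ?thesis by (simp add: linear_diff[OF U_linear])
qed

end

section \<open>Perturbation by a bounded accretive operator\<close>

locale perturbed_isometry_group = isometry_group U
  for U :: "real \<Rightarrow> 'a \<Rightarrow> 'a::{banach, real_inner}" +
  fixes K :: "'a \<Rightarrow> 'a"
  assumes K: "bounded_linear K" and K_nonneg: "0 \<le> inner (K x) x"
begin

text \<open>Conjugation with \<open>U\<close> removes the unbounded generator: formally,
  \<open>U t (v t)\<close> follows the perturbed dynamics when \<open>v' = G t v\<close>.\<close>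

definition G :: "real \<Rightarrow> 'a \<Rightarrow> 'a" where
  "G t x = - U (- t) (K (U t x))"

lemma G_linear: "linear (G t)"
  by (rule linearI)
    (simp_all add: G_def linear_add[OF U_linear] linear_scale[OF U_linear]
      linear_add[OF bounded_linear.linear[OF K]] linear_scale[OF bounded_linear.linear[OF K]])

definition is_solution :: "(real \<Rightarrow> 'a) \<Rightarrow> bool" where
  "is_solution v \<longleftrightarrow> (\<forall>t\<ge>0. (v has_vector_derivative G t (v t)) (at t within {0..}))"

lemma solution_exists: "\<exists>v. v 0 = x \<and> is_solution v"
proof -
  obtain k where k: "0 \<le> k" "\<And>x. norm (K x) \<le> norm x * k"
    using bounded_linear.nonneg_bounded[OF K] by blast
  show ?thesis
    unfolding is_solution_def
  proof (rule linear_ode_exists[OF G_linear])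
  show "0 \<le> k" by fact
  show "norm (G t x) \<le> k * norm x" for t x
    using k(2)[of "U t x"] by (simp add: G_def mult.commute)
  fix w :: "real \<Rightarrow> 'a" assume "continuous_on {0..} w"
  then show "continuous_on {0..} (\<lambda>t. G t (w t))"
    unfolding continuous_on_def G_def
    by (intro ballI tendsto_minus U_tendsto bounded_linear.tendsto[OF K] tendsto_ident_at) auto
  qed
qed

text \<open>Since the adjoint of \<open>U (- s)\<close> is \<open>U s\<close>,
  \<open>inner (G s v) v = - inner (K (U s v)) (U s v)\<close>, which is nonpositive by
  \<open>K_nonneg\<close>.\<close>

lemma solution_norm_le:
  assumes v: "is_solution v" and t: "0 \<le> t"
  shows "norm (v t) \<le> norm (v 0)"
proof -
  have "(norm (v t))\<^sup>2 \<le> (norm (v 0))\<^sup>2"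
  proof (rule DERIV_nonpos_imp_decreasing_open[OF t])
    fix s assume s: "0 < s" "s < t"
    then have "(v has_vector_derivative G s (v s)) (at s within {0..})"
      using v by (simp add: is_solution_def)
    then have d: "(v has_vector_derivative G s (v s)) (at s)"
      using s at_within_interior[of s "{0..}"] by simp
    have "((\<lambda>s. (norm (v s))\<^sup>2) has_real_derivative 2 * inner (G s (v s)) (v s)) (at s)"
      using has_real_derivative_inner[OF d d]
      by (simp add: power2_norm_eq_inner inner_commute flip: mult_2)
    moreover have "inner (G s (v s)) (v s) \<le> 0"
      using K_nonneg by (simp add: G_def U_inner)
    ultimately show "\<exists>y. ((\<lambda>s. (norm (v s))\<^sup>2) has_real_derivative y) (at s) \<and> y \<le> 0"
      by auto
  next
    have "continuous_on {0..} v"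
      using v unfolding is_solution_def
      by (intro continuous_on_vector_derivative[where f'="\<lambda>t. G t (v t)"]) simp
    then have "continuous_on {0..t} v" by (rule continuous_on_subset) auto
    then show "continuous_on {0..t} (\<lambda>s. (norm (v s))\<^sup>2)"
      by (intro continuous_intros)
  qed
  then show ?thesis by (rule power2_le_imp_le) simp
qed

lemma solution_lincomb:
  assumes "is_solution v" "is_solution w"
  shows "is_solution (\<lambda>t. a *\<^sub>R v t + b *\<^sub>R w t)"
  unfolding is_solution_def
proof (intro allI impI)
  fix t :: real assume "0 \<le> t"
  then have "((\<lambda>t. a *\<^sub>R v t + b *\<^sub>R w t) has_vector_derivative a *\<^sub>R G t (v t) + b *\<^sub>R G t (w t)) (at t within {0..})"
    using assms unfolding is_solution_def
    by (intro has_vector_derivative_add bounded_linear.has_vector_derivative[OF bounded_linear_scaleR_right]) auto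
  then show "((\<lambda>t. a *\<^sub>R v t + b *\<^sub>R w t) has_vector_derivative G t (a *\<^sub>R v t + b *\<^sub>R w t)) (at t within {0..})"
    by (simp add: linear_add[OF G_linear] linear_scale[OF G_linear])
qed

text \<open>The difference is a solution that starts at 0, so its norm stays 0.\<close>

lemma solution_unique:
  assumes "is_solution v" "is_solution w" "v 0 = w 0" "0 \<le> t"
  shows "v t = w t"
  using solution_norm_le[OF solution_lincomb[OF assms(1,2), of 1 "- 1"] assms(4)] assms(3) by simp

definition sol :: "'a \<Rightarrow> real \<Rightarrow> 'a" where
  "sol x = (SOME v. v 0 = x \<and> is_solution v)"

lemma sol_zero [simp]: "sol x 0 = x" and is_solution_sol: "is_solution (sol x)"
  using someI_ex[OF solution_exists[of x]] by (auto simp: sol_def)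

definition T :: "real \<Rightarrow> 'a \<Rightarrow> 'a" where
  "T t x = U t (sol x t)"

text \<open>The identity \<open>U s G(s + t) = G(t) U s\<close> turns the non-autonomous flow into a semigroup.\<close>

lemma sol_shift:
  assumes "0 \<le> s" "0 \<le> t"
  shows "U s (sol x (s + t)) = sol (T s x) t"
proof (rule solution_unique[OF _ is_solution_sol _ assms(2)])
  show "U s (sol x (s + 0)) = sol (T s x) 0" by (simp add: T_def)
  show "is_solution (\<lambda>t. U s (sol x (s + t)))"
    unfolding is_solution_def
  proof (intro allI impI)
    fix t :: real assume t: "0 \<le> t"
    have "(sol x has_vector_derivative G (s + t) (sol x (s + t))) (at (s + t) within {0..})"
      using is_solution_sol assms t by (simp add: is_solution_def)
    then have "(sol x has_vector_derivative G (s + t) (sol x (s + t))) (at (s + t) within (+) s ` {0..})"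
      by (rule has_vector_derivative_within_subset) (use assms in auto)
    then have "((\<lambda>t. sol x (s + t)) has_vector_derivative G (s + t) (sol x (s + t))) (at t within {0..})"
      using vector_diff_chain_within[of "(+) s" 1 t "{0..}" "sol x" "G (s + t) (sol x (s + t))"]
        has_vector_derivative_shift by (simp add: o_def)
    then have "((\<lambda>t. U s (sol x (s + t))) has_vector_derivative U s (G (s + t) (sol x (s + t)))) (at t within {0..})"
      by (rule bounded_linear.has_vector_derivative[OF U_bounded_linear])
    moreover have "U s (G (s + t) y) = G t (U s y)" for y
    proof -
      have "U s (U (- (s + t)) z) = U (- t) z" for z by (simp flip: U_add)
      moreover have "U (s + t) y = U t (U s y)" by (simp add: add.commute flip: U_add)
      ultimately show ?thesis by (simp add: G_def linear_neg[OF U_linear])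
    qed
    ultimately show "((\<lambda>t. U s (sol x (s + t))) has_vector_derivative G t (U s (sol x (s + t)))) (at t within {0..})"
      by simp
  qed
qed

lemma sol_quotient: "((\<lambda>h. (sol x h - x) /\<^sub>R h) \<longlongrightarrow> - K x) (at_right 0)"
proof -
  have "(sol x has_vector_derivative G 0 (sol x 0)) (at 0 within {0..})"
    using is_solution_sol unfolding is_solution_def by blast
  then show ?thesis
    by (simp add: has_vector_derivative_iff_quotient at_within_Ici_at_right G_def)
qed

lemma c0_semigroup_T: "c0_semigroup T"
  unfolding c0_semigroup_def
proof (intro conjI allI impI)
  fix t :: real assume t: "0 \<le> t"
  \<comment> \<open>Superposition follows from uniqueness; \<open>a = b = 1\<close> gives additivity
    and \<open>b = 0\<close> homogeneity.\<close>
  have "sol (a *\<^sub>R x + b *\<^sub>R y) t = a *\<^sub>R sol x t + b *\<^sub>R sol y t" for a b x y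
    by (rule solution_unique[OF is_solution_sol _ _ t]) (simp_all add: solution_lincomb is_solution_sol)
  from this[of 1 _ 1] this[of _ _ 0 0] show "bounded_linear (T t)"
    using solution_norm_le[OF is_solution_sol t]
    by (intro bounded_linear_intro[where K=1])
      (auto simp: T_def linear_add[OF U_linear] linear_scale[OF U_linear])
next
  show "T 0 = id" by (auto simp: T_def)
next
  fix s t :: real assume st: "0 \<le> s" "0 \<le> t"
  have "T (s + t) x = T s (T t x)" for x
    using sol_shift[OF st(2,1), of x] by (simp add: T_def add.commute[of t] U_add)
  then show "T (s + t) = T s \<circ> T t" by auto
next
  fix x
  have "continuous (at 0 within {0..}) (sol x)"
    using is_solution_sol unfolding is_solution_def
    by (intro has_vector_derivative_continuous[where D="G 0 (sol x 0)"]) blast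
  then have "(sol x \<longlongrightarrow> x) (at_right 0)"
    by (simp add: continuous_within at_within_Ici_at_right)
  then show "((\<lambda>t. T t x) \<longlongrightarrow> x) (at_right 0)"
    unfolding T_def using U_tendsto[of "\<lambda>t. t" 0 "at_right 0" "sol x" x] by simp
qed

text \<open>The quotient of \<open>T\<close> is that of \<open>U\<close> plus \<open>U h\<close>
  applied to the quotient of \<open>sol x\<close>. The latter tends to \<open>- K x\<close> for
  every \<open>x\<close>, so both limits exist for the same \<open>x\<close> and the domain is
  unchanged.\<close>

lemma generator_T:
  assumes "is_generator D A U"
  shows "is_generator D (\<lambda>x. A x - K x) T"
proof -
  have 1: "((\<lambda>h. U h ((sol x h - x) /\<^sub>R h)) \<longlongrightarrow> - K x) (at_right 0)" for x
    using U_tendsto[OF _ sol_quotient, of "\<lambda>h. h" 0] by simp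
  have 2: "U h ((sol x h - x) /\<^sub>R h) + (U h x - x) /\<^sub>R h = (T h x - x) /\<^sub>R h" for h x
    by (simp add: T_def linear_diff[OF U_linear] linear_scale[OF U_linear] flip: scaleR_add_right)
  have *: "((\<lambda>h. (T h x - x) /\<^sub>R h) \<longlongrightarrow> y - K x) (at_right 0) \<longleftrightarrow>
      ((\<lambda>h. (U h x - x) /\<^sub>R h) \<longlongrightarrow> y) (at_right 0)" for x y
  proof
    assume "((\<lambda>h. (T h x - x) /\<^sub>R h) \<longlongrightarrow> y - K x) (at_right 0)"
    from tendsto_diff[OF this 1[of x]] show "((\<lambda>h. (U h x - x) /\<^sub>R h) \<longlongrightarrow> y) (at_right 0)"
      by (simp flip: 2)
  next
    assume "((\<lambda>h. (U h x - x) /\<^sub>R h) \<longlongrightarrow> y) (at_right 0)"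
    from tendsto_add[OF 1[of x] this] show "((\<lambda>h. (T h x - x) /\<^sub>R h) \<longlongrightarrow> y - K x) (at_right 0)"
      by (simp add: 2)
  qed
  have "(\<exists>y. ((\<lambda>h. (T h x - x) /\<^sub>R h) \<longlongrightarrow> y) (at_right 0)) \<longleftrightarrow>
      (\<exists>y. ((\<lambda>h. (U h x - x) /\<^sub>R h) \<longlongrightarrow> y) (at_right 0))" for x
  proof
    assume "\<exists>y. ((\<lambda>h. (T h x - x) /\<^sub>R h) \<longlongrightarrow> y) (at_right 0)"
    then obtain y where "((\<lambda>h. (T h x - x) /\<^sub>R h) \<longlongrightarrow> (y + K x) - K x) (at_right 0)" by auto
    then show "\<exists>y. ((\<lambda>h. (U h x - x) /\<^sub>R h) \<longlongrightarrow> y) (at_right 0)" unfolding * ..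
  qed (use * in blast)
  then show ?thesis using assms by (simp add: is_generator_def *)
qed

end

section \<open>The unperturbed group\<close>

lemma ell2_norm_power2: "(norm x)\<^sup>2 = (\<Sum>j. (ell2_nth x j)\<^sup>2)"
  by (simp add: power2_norm_eq_inner inner_ell2_def flip: power2_eq_square)

lemma bounded_linear_ell2_nth: "bounded_linear (\<lambda>x. ell2_nth x j)"
  by (rule bounded_linear_intro[where K=1]) (use ell2_nth_le_norm in auto)

lemma summable_square_le:
  fixes a b :: "nat \<Rightarrow> real"
  assumes "summable (\<lambda>j. (b j)\<^sup>2)" "\<And>j. \<bar>a j\<bar> \<le> \<bar>b j\<bar>"
  shows "summable (\<lambda>j. (a j)\<^sup>2)"
  by (rule summable_comparison_test'[OF assms(1), of 0]) (use assms(2) in \<open>simp add: abs_le_square_iff\<close>)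

text \<open>Dominated convergence for series (Tannery's theorem), applied to the squared coordinates
  along an arbitrary filter.\<close>

lemma ell2_tendsto_zero:
  assumes lim: "\<And>j. ((\<lambda>i. ell2_nth (g i) j) \<longlongrightarrow> 0) F"
    and bound: "\<forall>\<^sub>F i in F. \<forall>j. \<bar>ell2_nth (g i) j\<bar> \<le> b j"
    and b: "summable (\<lambda>j. (b j)\<^sup>2)"
  shows "(g \<longlongrightarrow> 0) F"
proof (cases "F = bot")
  case False
  have "((\<lambda>i. \<Sum>j. (ell2_nth (g i) j)\<^sup>2) \<longlongrightarrow> (\<Sum>j. 0)) F"
  proof (rule tannerys_theorem[THEN conjunct2, THEN conjunct2, OF _ _ b False])
    show "((\<lambda>i. (ell2_nth (g i) j)\<^sup>2) \<longlongrightarrow> 0) F" for j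
      using tendsto_power[OF lim, of j 2] by simp
    have "\<forall>\<^sub>F i in F. \<forall>j. norm ((ell2_nth (g i) j)\<^sup>2) \<le> (b j)\<^sup>2"
      by (rule eventually_mono[OF bound]) (auto simp flip: abs_le_square_iff intro: order_trans[OF _ abs_ge_self])
    \<comment> \<open>Tannery's theorem asks for the bound on a product filter in which
      \<open>j\<close> is large; here it holds for every \<open>j\<close>, so projecting to
      \<open>i\<close> suffices.\<close>
    from eventually_compose_filterlim[OF this filterlim_snd, of at_top]
    show "\<forall>\<^sub>F (j, i) in at_top \<times>\<^sub>F F. norm ((ell2_nth (g i) j)\<^sup>2) \<le> (b j)\<^sup>2"
      by (rule eventually_mono) auto
  qed
  then have "((\<lambda>i. sqrt ((norm (g i))\<^sup>2)) \<longlongrightarrow> sqrt 0) F"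
    unfolding ell2_norm_power2 by (intro tendsto_intros) simp
  then show ?thesis by (simp add: tendsto_norm_zero_iff)
qed simp

lemma H_tendsto_zero:
  fixes g :: "'i \<Rightarrow> H"
  assumes "\<And>j. ((\<lambda>i. ell2_nth (fst (g i)) j) \<longlongrightarrow> 0) F" "\<And>j. ((\<lambda>i. ell2_nth (snd (g i)) j) \<longlongrightarrow> 0) F"
    and "\<forall>\<^sub>F i in F. \<forall>j. \<bar>ell2_nth (fst (g i)) j\<bar> \<le> b j \<and> \<bar>ell2_nth (snd (g i)) j\<bar> \<le> b j"
    and "summable (\<lambda>j. (b j)\<^sup>2)"
  shows "(g \<longlongrightarrow> 0) F"
proof -
  have "((\<lambda>i. (fst (g i), snd (g i))) \<longlongrightarrow> (0, 0)) F"
    using assms(3) by (intro tendsto_Pair ell2_tendsto_zero[OF assms(1) _ assms(4)]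
        ell2_tendsto_zero[OF assms(2) _ assms(4)]) (auto elim: eventually_mono)
  then show ?thesis by (simp add: zero_prod_def)
qed

lemma H_eqI:
  fixes x y :: H
  assumes "\<And>j. ell2_nth (fst x) j = ell2_nth (fst y) j" "\<And>j. ell2_nth (snd x) j = ell2_nth (snd y) j"
  shows "x = y"
  using assms by (intro prod_eqI ell2_eqI)

lemma H_norm_power2:
  fixes z :: H
  shows "(norm z)\<^sup>2 = (\<Sum>j. (ell2_nth (fst z) j)\<^sup>2 + (ell2_nth (snd z) j)\<^sup>2)"
proof -
  have "(norm z)\<^sup>2 = (norm (fst z))\<^sup>2 + (norm (snd z))\<^sup>2" by (simp add: norm_prod_def)
  then show ?thesis by (simp add: ell2_norm_power2 suminf_add ell2_nth_summable)
qed

lemma ell2_nth_diag_op: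
  "summable (\<lambda>j. (a j * ell2_nth x j)\<^sup>2) \<Longrightarrow> ell2_nth (diag_op a x) j = a j * ell2_nth x j"
  by (simp add: diag_op_def ell2_nth_ell2_of)

lemma ell2_nth_diag_op_bounded:
  assumes "\<And>j. \<bar>a j\<bar> \<le> 1"
  shows "ell2_nth (diag_op a x) j = a j * ell2_nth x j"
  by (intro ell2_nth_diag_op summable_square_le[OF ell2_nth_summable[of x]])
    (simp add: abs_mult mult_left_le_one_le assms)

lemma dom_A_iff:
  "z \<in> dom_A \<omega> \<longleftrightarrow> summable (\<lambda>j. (\<omega> j * ell2_nth (fst z) j)\<^sup>2) \<and> summable (\<lambda>j. (\<omega> j * ell2_nth (snd z) j)\<^sup>2)"
proof -
  have "z \<in> dom_A \<omega> \<longleftrightarrow> summable (\<lambda>j. (\<omega> j * ell2_nth (fst z) j)\<^sup>2 + (\<omega> j * ell2_nth (snd z) j)\<^sup>2)"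
    by (cases z) (simp add: dom_A_def power_mult_distrib distrib_left)
  also have "\<dots> \<longleftrightarrow> summable (\<lambda>j. (\<omega> j * ell2_nth (fst z) j)\<^sup>2) \<and> summable (\<lambda>j. (\<omega> j * ell2_nth (snd z) j)\<^sup>2)"
  proof (intro iffI conjI)
    assume S: "summable (\<lambda>j. (\<omega> j * ell2_nth (fst z) j)\<^sup>2 + (\<omega> j * ell2_nth (snd z) j)\<^sup>2)"
    show "summable (\<lambda>j. (\<omega> j * ell2_nth (fst z) j)\<^sup>2)" "summable (\<lambda>j. (\<omega> j * ell2_nth (snd z) j)\<^sup>2)"
      by (rule summable_comparison_test'[OF S, of 0]; simp)+
  qed (simp add: summable_add)
  finally show ?thesis .
qed

lemma op_A_nth:
  assumes "z \<in> dom_A \<omega>"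
  shows "ell2_nth (fst (op_A \<omega> z)) j = \<omega> j * ell2_nth (snd z) j"
    "ell2_nth (snd (op_A \<omega> z)) j = - (\<omega> j * ell2_nth (fst z) j)"
  using assms by (auto simp: dom_A_iff op_A_def ell2_nth_diag_op split: prod.split)

lemma dom_A_diff:
  assumes "x \<in> dom_A \<omega>" "y \<in> dom_A \<omega>"
  shows "x - y \<in> dom_A \<omega>" "op_A \<omega> (x - y) = op_A \<omega> x - op_A \<omega> y"
proof -
  have "summable (\<lambda>j. (\<omega> j * (a j - b j))\<^sup>2)"
    if "summable (\<lambda>j. (\<omega> j * a j)\<^sup>2)" "summable (\<lambda>j. (\<omega> j * b j)\<^sup>2)" for a b
    using summable_square_add[OF that(1) summable_square_scale[OF that(2), of "- 1"]]
    by (simp add: right_diff_distrib)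
  then show D: "x - y \<in> dom_A \<omega>"
    using assms by (simp add: dom_A_iff)
  show "op_A \<omega> (x - y) = op_A \<omega> x - op_A \<omega> y"
    by (rule H_eqI) (simp_all add: op_A_nth[OF D] op_A_nth[OF assms(1)] op_A_nth[OF assms(2)] right_diff_distrib)
qed

text \<open>Both components yield the series of \<open>\<omega> j * \<xi> j * \<eta> j\<close>, with
  opposite signs.\<close>

lemma op_A_skew:
  assumes "z \<in> dom_A \<omega>"
  shows "inner (op_A \<omega> z) z = 0"
proof -
  have "inner (snd (op_A \<omega> z)) (snd z) = - inner (fst (op_A \<omega> z)) (fst z)"
    unfolding inner_ell2_def suminf_minus[OF ell2_inner_summable, symmetric]
    by (simp add: op_A_nth[OF assms] ac_simps)
  then show ?thesis by (simp add: inner_prod_def)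
qed

text \<open>Truncations to the first \<open>n\<close> coordinates lie in the domain whatever the
  weights, and converge by domination.\<close>

lemma closure_dom_A: "closure (dom_A \<omega>) = UNIV"
proof -
  have "z \<in> closure (dom_A \<omega>)" for z
    unfolding closure_sequential
  proof (intro exI conjI allI)
    define p :: "nat \<Rightarrow> nat \<Rightarrow> real" where "p n j = of_bool (j < n)" for n j
    define f where "f n = (diag_op (p n) (fst z), diag_op (p n) (snd z))" for n
    have nth: "ell2_nth (diag_op (p n) x) j = p n j * ell2_nth x j" for n x j
      by (rule ell2_nth_diag_op_bounded) (simp add: p_def)
    show "f n \<in> dom_A \<omega>" for n
      unfolding dom_A_iff f_def
      by (auto simp: nth p_def intro!: summable_finite[of "{..<n}"])
    have "((\<lambda>n. f n - z) \<longlongrightarrow> 0) sequentially"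
    proof (rule H_tendsto_zero)
      have "\<forall>\<^sub>F n in sequentially. (p n j - 1) * a = 0" for j a
        by (rule eventually_mono[OF eventually_gt_at_top[of j]]) (simp add: p_def)
      then have *: "(\<lambda>n. (p n j - 1) * a) \<longlonglongrightarrow> 0" for j a
        by (rule tendsto_eventually)
      show "(\<lambda>n. ell2_nth (fst (f n - z)) j) \<longlonglongrightarrow> 0" for j
        using *[of j "ell2_nth (fst z) j"] by (simp add: f_def nth left_diff_distrib)
      show "(\<lambda>n. ell2_nth (snd (f n - z)) j) \<longlonglongrightarrow> 0" for j
        using *[of j "ell2_nth (snd z) j"] by (simp add: f_def nth left_diff_distrib)
      show "summable (\<lambda>j. (\<bar>ell2_nth (fst z) j\<bar> + \<bar>ell2_nth (snd z) j\<bar>)\<^sup>2)"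
        by (intro summable_square_add) (simp_all add: ell2_nth_summable)
      show "\<forall>\<^sub>F n in sequentially. \<forall>j. \<bar>ell2_nth (fst (f n - z)) j\<bar> \<le> \<bar>ell2_nth (fst z) j\<bar> + \<bar>ell2_nth (snd z) j\<bar> \<and>
          \<bar>ell2_nth (snd (f n - z)) j\<bar> \<le> \<bar>ell2_nth (fst z) j\<bar> + \<bar>ell2_nth (snd z) j\<bar>"
        by (simp add: f_def nth p_def)
    qed
    then show "f \<longlonglongrightarrow> z" by (rule LIM_zero_cancel)
  qed
  then show ?thesis by blast
qed

text \<open>The explicit group \<open>e^(tA)\<close>, for times of either sign: in the plane of mode
  \<open>j\<close> it rotates clockwise by the angle \<open>\<omega> j * t\<close>.\<close>

definition rot :: "(nat \<Rightarrow> real) \<Rightarrow> real \<Rightarrow> H \<Rightarrow> H" where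
  "rot \<omega> t z =
    (diag_op (\<lambda>j. cos (\<omega> j * t)) (fst z) + diag_op (\<lambda>j. sin (\<omega> j * t)) (snd z),
     diag_op (\<lambda>j. cos (\<omega> j * t)) (snd z) - diag_op (\<lambda>j. sin (\<omega> j * t)) (fst z))"

lemma rot_nth:
  "ell2_nth (fst (rot \<omega> t z)) j = cos (\<omega> j * t) * ell2_nth (fst z) j + sin (\<omega> j * t) * ell2_nth (snd z) j"
  "ell2_nth (snd (rot \<omega> t z)) j = cos (\<omega> j * t) * ell2_nth (snd z) j - sin (\<omega> j * t) * ell2_nth (fst z) j"
  by (simp_all add: rot_def ell2_nth_diag_op_bounded)

lemma rot_continuous: "continuous_on UNIV (\<lambda>t. rot \<omega> t z)"
  unfolding continuous_on_def
proof (intro ballI)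
  fix t :: real
  let ?b = "\<lambda>j. 2 * (\<bar>ell2_nth (fst z) j\<bar> + \<bar>ell2_nth (snd z) j\<bar>)"
  have bound: "\<bar>(c * x + s * y) - (c' * x + s' * y)\<bar> \<le> 2 * (\<bar>x\<bar> + \<bar>y\<bar>)"
    if "\<bar>c\<bar> \<le> 1" "\<bar>s\<bar> \<le> 1" "\<bar>c'\<bar> \<le> 1" "\<bar>s'\<bar> \<le> 1" for c s c' s' x y :: real
  proof -
    have "\<bar>(c - c') * x + (s - s') * y\<bar> \<le> \<bar>c - c'\<bar> * \<bar>x\<bar> + \<bar>s - s'\<bar> * \<bar>y\<bar>"
      by (metis abs_mult abs_triangle_ineq)
    also have "\<dots> \<le> 2 * \<bar>x\<bar> + 2 * \<bar>y\<bar>"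
      using that by (intro add_mono mult_right_mono) auto
    finally show ?thesis by (simp add: algebra_simps)
  qed
  have "((\<lambda>s. rot \<omega> s z - rot \<omega> t z) \<longlongrightarrow> 0) (at t within UNIV)"
  proof (rule H_tendsto_zero)
    show "((\<lambda>s. ell2_nth (fst (rot \<omega> s z - rot \<omega> t z)) j) \<longlongrightarrow> 0) (at t within UNIV)" for j
      by (auto simp: rot_nth intro!: LIM_zero tendsto_intros)
    show "((\<lambda>s. ell2_nth (snd (rot \<omega> s z - rot \<omega> t z)) j) \<longlongrightarrow> 0) (at t within UNIV)" for j
      by (auto simp: rot_nth intro!: LIM_zero tendsto_intros)
    show "summable (\<lambda>j. (?b j)\<^sup>2)"
      by (intro summable_square_scale summable_square_add) (simp_all add: ell2_nth_summable)
    show "\<forall>\<^sub>F s in at t within UNIV. \<forall>j. \<bar>ell2_nth (fst (rot \<omega> s z - rot \<omega> t z)) j\<bar> \<le> ?b j \<and>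
        \<bar>ell2_nth (snd (rot \<omega> s z - rot \<omega> t z)) j\<bar> \<le> ?b j"
    proof (intro always_eventually allI conjI)
      fix s j
      let ?a = "\<omega> j * s" and ?b = "\<omega> j * t"
      show "\<bar>ell2_nth (fst (rot \<omega> s z - rot \<omega> t z)) j\<bar> \<le> 2 * (\<bar>ell2_nth (fst z) j\<bar> + \<bar>ell2_nth (snd z) j\<bar>)"
        using bound[of "cos ?a" "sin ?a" "cos ?b" "sin ?b"] by (simp add: rot_nth)
      show "\<bar>ell2_nth (snd (rot \<omega> s z - rot \<omega> t z)) j\<bar> \<le> 2 * (\<bar>ell2_nth (fst z) j\<bar> + \<bar>ell2_nth (snd z) j\<bar>)"
        using bound[of "cos ?a" "- sin ?a" "cos ?b" "- sin ?b" "ell2_nth (snd z) j" "ell2_nth (fst z) j"]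
        by (simp add: rot_nth)
    qed
  qed
  then show "((\<lambda>t. rot \<omega> t z) \<longlongrightarrow> rot \<omega> t z) (at t within UNIV)" by (rule LIM_zero_cancel)
qed

lemma isometry_group_rot: "isometry_group (rot \<omega>)"
proof
  fix s t :: real and x y :: H and r :: real
  show "rot \<omega> t (x + y) = rot \<omega> t x + rot \<omega> t y" "rot \<omega> t (r *\<^sub>R x) = r *\<^sub>R rot \<omega> t x"
    "rot \<omega> 0 x = x" "rot \<omega> (s + t) x = rot \<omega> s (rot \<omega> t x)"
    by (rule H_eqI; simp add: rot_nth algebra_simps cos_add sin_add)+
  have "(cos a * u + sin a * v)\<^sup>2 + (cos a * v - sin a * u)\<^sup>2 = u\<^sup>2 + v\<^sup>2" for a u v :: real
  proof -
    have "(cos a * u + sin a * v)\<^sup>2 + (cos a * v - sin a * u)\<^sup>2 = ((cos a)\<^sup>2 + (sin a)\<^sup>2) * (u\<^sup>2 + v\<^sup>2)"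
      by algebra
    then show ?thesis by simp
  qed
  then have "(norm (rot \<omega> t x))\<^sup>2 = (norm x)\<^sup>2"
    unfolding H_norm_power2 by (simp add: rot_nth)
  then show "norm (rot \<omega> t x) = norm x" by simp
  show "continuous_on UNIV (\<lambda>t. rot \<omega> t x)" by (rule rot_continuous)
qed

lemma rot_coefficient_limits:
  fixes a :: real
  shows "((\<lambda>h. (cos (a * h) - 1) / h) \<longlongrightarrow> 0) (at_right 0)" "((\<lambda>h. sin (a * h) / h) \<longlongrightarrow> a) (at_right 0)"
proof -
  have "((\<lambda>h. cos (a * h)) has_real_derivative 0) (at 0)" "((\<lambda>h. sin (a * h)) has_real_derivative a) (at 0)"
    by (auto intro!: derivative_eq_intros)
  then have "((\<lambda>h. (cos (a * h) - 1) / h) \<longlongrightarrow> 0) (at 0)" "((\<lambda>h. sin (a * h) / h) \<longlongrightarrow> a) (at 0)"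
    by (simp_all add: has_field_derivative_iff)
  then show "((\<lambda>h. (cos (a * h) - 1) / h) \<longlongrightarrow> 0) (at_right 0)" "((\<lambda>h. sin (a * h) / h) \<longlongrightarrow> a) (at_right 0)"
    by (auto intro: tendsto_within_subset)
qed

lemma rot_quotient_nth:
  "ell2_nth (fst ((rot \<omega> h z - z) /\<^sub>R h)) j =
    (cos (\<omega> j * h) - 1) / h * ell2_nth (fst z) j + sin (\<omega> j * h) / h * ell2_nth (snd z) j"
  "ell2_nth (snd ((rot \<omega> h z - z) /\<^sub>R h)) j =
    (cos (\<omega> j * h) - 1) / h * ell2_nth (snd z) j - sin (\<omega> j * h) / h * ell2_nth (fst z) j"
  by (simp_all add: rot_nth divide_inverse algebra_simps)

lemma rot_quotient_nth_limits:
  "((\<lambda>h. ell2_nth (fst ((rot \<omega> h z - z) /\<^sub>R h)) j) \<longlongrightarrow> \<omega> j * ell2_nth (snd z) j) (at_right 0)"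
  "((\<lambda>h. ell2_nth (snd ((rot \<omega> h z - z) /\<^sub>R h)) j) \<longlongrightarrow> - (\<omega> j * ell2_nth (fst z) j)) (at_right 0)"
  using tendsto_add[OF tendsto_mult[OF rot_coefficient_limits(1) tendsto_const]
      tendsto_mult[OF rot_coefficient_limits(2) tendsto_const], of "\<omega> j"]
    tendsto_diff[OF tendsto_mult[OF rot_coefficient_limits(1) tendsto_const]
      tendsto_mult[OF rot_coefficient_limits(2) tendsto_const], of "\<omega> j"]
  unfolding rot_quotient_nth by fastforce+

text \<open>The coordinates converge, and both coefficients of the quotient are at most
  \<open>\<bar>\<omega> j\<bar>\<close> in modulus for all \<open>h > 0\<close>; membership in the
  domain makes the resulting majorant square-summable.\<close>

lemma rot_quotient_limit:
  assumes z: "z \<in> dom_A \<omega>"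
  shows "((\<lambda>h. (rot \<omega> h z - z) /\<^sub>R h) \<longlongrightarrow> op_A \<omega> z) (at_right 0)"
proof (rule LIM_zero_cancel, rule H_tendsto_zero)
  let ?b = "\<lambda>j. 2 * (\<bar>\<omega> j * ell2_nth (fst z) j\<bar> + \<bar>\<omega> j * ell2_nth (snd z) j\<bar>)"
  show "((\<lambda>h. ell2_nth (fst ((rot \<omega> h z - z) /\<^sub>R h - op_A \<omega> z)) j) \<longlongrightarrow> 0) (at_right 0)" for j
    using LIM_zero[OF rot_quotient_nth_limits(1)[of \<omega> z j]] by (simp add: op_A_nth[OF z])
  show "((\<lambda>h. ell2_nth (snd ((rot \<omega> h z - z) /\<^sub>R h - op_A \<omega> z)) j) \<longlongrightarrow> 0) (at_right 0)" for j
    using LIM_zero[OF rot_quotient_nth_limits(2)[of \<omega> z j]] by (simp add: op_A_nth[OF z])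
  show "summable (\<lambda>j. (?b j)\<^sup>2)"
    using z by (intro summable_square_scale summable_square_add) (simp_all add: dom_A_iff)
  have coeff: "\<bar>(cos (a * h) - 1) / h\<bar> \<le> \<bar>a\<bar>" "\<bar>sin (a * h) / h\<bar> \<le> \<bar>a\<bar>" if "0 < h" for a h :: real
  proof -
    have "\<bar>sin (a * h)\<bar> \<le> \<bar>a\<bar> * h"
      using abs_sin_x_le_abs_x[of "a * h"] that by (simp add: abs_mult)
    then show "\<bar>sin (a * h) / h\<bar> \<le> \<bar>a\<bar>" using that by (simp add: field_simps)
    \<comment> \<open>The half-angle formula gives a bound linear in \<open>h\<close>: one sine
      factor is estimated by its argument, the other by 1.\<close>
    have "cos (a * h) - 1 = - 2 * (sin (a * h / 2))\<^sup>2" using cos_double_sin[of "a * h / 2"] by simp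
    then have "\<bar>cos (a * h) - 1\<bar> = 2 * (\<bar>sin (a * h / 2)\<bar> * \<bar>sin (a * h / 2)\<bar>)"
      by (simp add: power2_eq_square)
    also have "\<dots> \<le> 2 * (\<bar>a * h / 2\<bar> * 1)"
      by (intro mult_left_mono mult_mono abs_sin_x_le_abs_x) auto
    finally show "\<bar>(cos (a * h) - 1) / h\<bar> \<le> \<bar>a\<bar>" using that by (simp add: field_simps abs_mult)
  qed
  have bound: "\<bar>c * x + s * y - a * y\<bar> \<le> 2 * (\<bar>a * x\<bar> + \<bar>a * y\<bar>)" if "\<bar>c\<bar> \<le> \<bar>a\<bar>" "\<bar>s\<bar> \<le> \<bar>a\<bar>" for c s a x y :: real
  proof -
    have "\<bar>c * x + s * y - a * y\<bar> \<le> \<bar>c * x\<bar> + \<bar>s * y\<bar> + \<bar>a * y\<bar>" by linarith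
    also have "\<dots> \<le> \<bar>a * x\<bar> + \<bar>a * y\<bar> + \<bar>a * y\<bar>"
      unfolding abs_mult using that by (intro add_mono mult_right_mono) auto
    finally show ?thesis by simp
  qed
  show "\<forall>\<^sub>F h in at_right 0. \<forall>j. \<bar>ell2_nth (fst ((rot \<omega> h z - z) /\<^sub>R h - op_A \<omega> z)) j\<bar> \<le> ?b j \<and>
      \<bar>ell2_nth (snd ((rot \<omega> h z - z) /\<^sub>R h - op_A \<omega> z)) j\<bar> \<le> ?b j"
  proof (rule eventually_mono[OF eventually_at_right_less], intro allI)
    fix h :: real and j assume h: "0 < h"
    let ?c = "(cos (\<omega> j * h) - 1) / h" and ?s = "sin (\<omega> j * h) / h"
    let ?x = "ell2_nth (fst z) j" and ?y = "ell2_nth (snd z) j"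
    have "ell2_nth (fst ((rot \<omega> h z - z) /\<^sub>R h - op_A \<omega> z)) j = ?c * ?x + ?s * ?y - \<omega> j * ?y"
      "ell2_nth (snd ((rot \<omega> h z - z) /\<^sub>R h - op_A \<omega> z)) j = ?c * ?y + - ?s * ?x - (- \<omega> j) * ?x"
      by (simp_all only: fst_diff snd_diff ell2_nth_diff rot_quotient_nth op_A_nth[OF z])
    moreover have "\<bar>?c * ?x + ?s * ?y - \<omega> j * ?y\<bar> \<le> ?b j"
      by (rule bound) (use coeff[OF h] in auto)
    \<comment> \<open>\<open>bound\<close> is reused with \<open>a = - \<omega> j\<close> and the
      coordinates exchanged, to match the sign in the second component of
      \<open>op_A\<close>.\<close>
    moreover have "\<bar>?c * ?y + - ?s * ?x - (- \<omega> j) * ?x\<bar> \<le> 2 * (\<bar>(- \<omega> j) * ?y\<bar> + \<bar>(- \<omega> j) * ?x\<bar>)"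
      by (rule bound) (use coeff[OF h] in \<open>auto simp del: abs_divide\<close>)
    ultimately show "\<bar>ell2_nth (fst ((rot \<omega> h z - z) /\<^sub>R h - op_A \<omega> z)) j\<bar> \<le> ?b j \<and>
      \<bar>ell2_nth (snd ((rot \<omega> h z - z) /\<^sub>R h - op_A \<omega> z)) j\<bar> \<le> ?b j"
      by (simp only:) (simp add: add.commute)
  qed
qed

text \<open>If the quotient converges in \<open>H\<close>, so do its coordinates; hence the
  \<open>\<omega> j\<close>-multiples of the coordinates of \<open>z\<close> are, up to sign,
  coordinates of the limit and therefore square-summable.\<close>

lemma is_generator_rot: "is_generator (dom_A \<omega>) (op_A \<omega>) (rot \<omega>)"
  unfolding is_generator_def
proof (intro conjI ballI rot_quotient_limit)
  show "dom_A \<omega> = {z. \<exists>y. ((\<lambda>h. (rot \<omega> h z - z) /\<^sub>R h) \<longlongrightarrow> y) (at_right 0)}"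
  proof (intro equalityI subsetI CollectI)
    fix z assume "z \<in> {z. \<exists>y. ((\<lambda>h. (rot \<omega> h z - z) /\<^sub>R h) \<longlongrightarrow> y) (at_right 0)}"
    then obtain y where y: "((\<lambda>h. (rot \<omega> h z - z) /\<^sub>R h) \<longlongrightarrow> y) (at_right 0)" by blast
    note nth = bounded_linear.tendsto[OF bounded_linear_ell2_nth]
    have "\<omega> j * ell2_nth (snd z) j = ell2_nth (fst y) j" for j
      using tendsto_unique[OF trivial_limit_at_right_real rot_quotient_nth_limits(1) nth[OF tendsto_fst[OF y]]] .
    moreover have "\<omega> j * ell2_nth (fst z) j = ell2_nth (- snd y) j" for j
      using tendsto_unique[OF trivial_limit_at_right_real rot_quotient_nth_limits(2) nth[OF tendsto_snd[OF y]], of j]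
      by simp
    ultimately show "z \<in> dom_A \<omega>"
      unfolding dom_A_iff by (simp only: ell2_nth_summable simp_thms)
  qed (use rot_quotient_limit in blast)
qed

section \<open>Decay from an integral estimate\<close>

text \<open>At some time \<open>E\<close> is within \<open>r\<close> of its infimum, and
  monotonicity keeps it there.\<close>

lemma nonincreasing_small_variation:
  fixes E :: "real \<Rightarrow> real"
  assumes mono: "\<And>s t. 0 < s \<Longrightarrow> s \<le> t \<Longrightarrow> E t \<le> E s" and nonneg: "\<And>t. 0 < t \<Longrightarrow> 0 \<le> E t" and r: "0 < r"
  obtains a where "0 < a" "\<And>s t. a \<le> s \<Longrightarrow> s \<le> t \<Longrightarrow> E s - E t \<le> r"
proof -
  have bdd: "bdd_below (E ` {0<..})" by (rule bdd_belowI[of _ 0]) (use nonneg in auto)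
  obtain a where a: "0 < a" "E a < Inf (E ` {0<..}) + r"
    using cInf_lessD[of "E ` {0<..}" "Inf (E ` {0<..}) + r"] r by auto
  show thesis
  proof (rule that[OF a(1)])
    fix s t assume st: "a \<le> s" "s \<le> t"
    have "E s \<le> E a" by (rule mono) (use a st in auto)
    moreover have "Inf (E ` {0<..}) \<le> E t" by (rule cINF_lower[OF bdd]) (use a st in auto)
    ultimately show "E s - E t \<le> r" using a by linarith
  qed
qed

text \<open>In the application \<open>E\<close> is the squared norm, \<open>e\<close> its
  dissipation, \<open>f\<close> the energy of a mode and \<open>Q\<close> the quadratic functional.
  Over a window of length \<open>L\<close> the bound on \<open>Q\<close> limits the integral of
  \<open>f\<close>, up to the integral of \<open>sqrt e\<close>, which is controlled by the late,
  hence small, drop of \<open>E\<close>. As \<open>f\<close> falls only at a rate governed by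
  \<open>sqrt e\<close>, its value at the start of the window is small too.\<close>

lemma integral_observability:
  fixes E e f Q :: "real \<Rightarrow> real"
  assumes E: "\<And>t. 0 < t \<Longrightarrow> (E has_real_derivative - e t) (at t)" and E0: "\<And>t. 0 < t \<Longrightarrow> 0 \<le> E t"
    and e0: "\<And>t. 0 < t \<Longrightarrow> 0 \<le> e t"
    and f: "\<And>t. 0 < t \<Longrightarrow> (f has_real_derivative f' t) (at t)" and f': "\<And>t. 0 < t \<Longrightarrow> - a * sqrt (e t) \<le> f' t"
    and f0: "\<And>t. 0 < t \<Longrightarrow> 0 \<le> f t"
    and Q: "\<And>t. 0 < t \<Longrightarrow> (Q has_real_derivative Q' t) (at t)"
    and Q': "\<And>t. 0 < t \<Longrightarrow> Q' t \<le> - c * f t + b * sqrt (e t)"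
    and QM: "\<And>t. 0 < t \<Longrightarrow> \<bar>Q t\<bar> \<le> M"
    and c: "0 < c" and a: "0 \<le> a"
  shows "(f \<longlongrightarrow> 0) at_top"
proof (rule tendstoI)
  fix d :: real assume d: "0 < d"
  \<comment> \<open>\<open>c * L * f t\<close> will be bounded by three errors of at most
    \<open>c * L * d / 4\<close> each: the boundary values of \<open>Q\<close>, the drop of
    \<open>E\<close>, and \<open>r * L\<close>. \<open>B\<close> collects the coefficients of
    \<open>sqrt (e s)\<close>; the 1 in \<open>L\<close> keeps the window nondegenerate when
    \<open>M = 0\<close>.\<close>
  define r where "r = c * d / 4"
  define L where "L = 8 * \<bar>M\<bar> / (c * d) + 1"
  define B where "B = b + c * L * a"
  define k where "k = B\<^sup>2 / (4 * r)"
  have r: "0 < r" and L: "0 < L" and k: "0 \<le> k"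
    using c d by (auto simp: r_def L_def k_def add_nonneg_pos)
  have M_le: "2 * M \<le> c * L * d / 4"
  proof -
    have "c * L * d / 4 = 2 * \<bar>M\<bar> + c * d / 4" using c d by (simp add: L_def field_simps)
    then show ?thesis using mult_pos_pos[OF c d] abs_ge_self[of M] by linarith
  qed
  \<comment> \<open>Completing the square trades the term in \<open>sqrt e\<close> for a constant
    rate \<open>r\<close>, paid by the length of the window, and \<open>k * e\<close>, paid by the
    drop of \<open>E\<close>.\<close>
  have amgm: "B * x \<le> r + k * x\<^sup>2" for x
  proof -
    have "0 \<le> (2 * r - B * x)\<^sup>2 / (4 * r)" using r by simp
    also have "\<dots> = r - B * x + k * x\<^sup>2"
      using r by (simp add: k_def power2_eq_square field_simps)
    finally show ?thesis by simp
  qed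
  have mono: "E t \<le> E s" if "0 < s" "s \<le> t" for s t
    by (rule DERIV_nonpos_imp_nonincreasing[OF that(2)]) (use that E e0 in \<open>meson less_le_trans neg_le_0_iff_le\<close>)
  \<comment> \<open>The denominator contains \<open>k + 1\<close> because \<open>k\<close> may
    vanish.\<close>
  have "0 < c * L * d / (4 * (k + 1))" using c L d k by simp
  from nonincreasing_small_variation[of E, OF mono E0 this]
  obtain T where T: "0 < T" and var: "\<And>s t. T \<le> s \<Longrightarrow> s \<le> t \<Longrightarrow> E s - E t \<le> c * L * d / (4 * (k + 1))"
    by metis
  have "f t < d" if t: "T \<le> t" for t
  proof -
    \<comment> \<open>The weight \<open>t + L - s\<close> trades the integral of \<open>f\<close> over \<open>[t, t + L]\<close> for its value at \<open>t\<close>.\<close>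
    define W where "W s = Q s - c * (t + L - s) * f s + k * E s - r * s" for s
    have "W (t + L) \<le> W t"
    proof (rule DERIV_nonpos_imp_nonincreasing[of t "t + L" W])
      fix s assume s: "t \<le> s" "s \<le> t + L"
      then have s0: "0 < s" using T t by simp
      let ?D = "Q' s - (c * (t + L - s) * f' s - c * f s) + k * - e s - r"
      have "(W has_real_derivative ?D) (at s)"
        unfolding W_def[abs_def]
        by (auto intro!: derivative_eq_intros E[OF s0] f[OF s0] Q[OF s0] simp: algebra_simps)
      moreover have "?D \<le> 0"
      proof -
        have "c * (t + L - s) * (- f' s) \<le> c * (t + L - s) * (a * sqrt (e s))"
          using f'[OF s0] c s by (intro mult_left_mono) auto
        also have "\<dots> \<le> c * L * (a * sqrt (e s))"
          using c s a e0[OF s0] by (intro mult_right_mono mult_left_mono) auto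
        finally have "?D \<le> b * sqrt (e s) + c * L * (a * sqrt (e s)) - k * e s - r"
          using Q'[OF s0] by simp
        also have "\<dots> = B * sqrt (e s) - k * (sqrt (e s))\<^sup>2 - r"
          using e0[OF s0] by (simp add: B_def algebra_simps)
        also have "\<dots> \<le> 0" using amgm[of "sqrt (e s)"] by simp
        finally show ?thesis .
      qed
      ultimately show "\<exists>y. (W has_real_derivative y) (at s) \<and> y \<le> 0" by blast
    qed (use L in simp)
    then have "c * L * f t \<le> Q t - Q (t + L) + k * (E t - E (t + L)) + r * L"
      by (simp add: W_def algebra_simps)
    also have "\<dots> \<le> 2 * M + k * (c * L * d / (4 * (k + 1))) + r * L"
    proof -
      have "Q t \<le> M" "- Q (t + L) \<le> M"
        using QM[of t] QM[of "t + L"] T t L by (auto simp: abs_le_iff)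
      moreover have "k * (E t - E (t + L)) \<le> k * (c * L * d / (4 * (k + 1)))"
        using var[of t "t + L"] t L k by (intro mult_left_mono) auto
      ultimately show ?thesis by linarith
    qed
    also have "k * (c * L * d / (4 * (k + 1))) = k / (k + 1) * (c * L * d / 4)" by simp
    also have "k / (k + 1) * (c * L * d / 4) \<le> 1 * (c * L * d / 4)"
      using k c L d by (intro mult_right_mono) auto
    also have "r * L = c * L * d / 4" by (simp add: r_def)
    finally have "c * L * f t \<le> 3 / 4 * (c * L * d)" using M_le by (simp add: algebra_simps)
    also have "\<dots> < c * L * d" using c L d by simp
    finally show ?thesis using c L by simp
  qed
  then show "\<forall>\<^sub>F t in at_top. dist (f t) 0 < d"
    using T f0 by (intro eventually_at_top_linorderI[of T]) (auto simp: dist_norm abs_of_nonneg)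
qed


section \<open>The closed loop\<close>

locale observer =
  fixes \<omega> :: "nat \<Rightarrow> real" and c :: "'r::finite \<Rightarrow> nat \<Rightarrow> real" and \<gamma> :: "'r \<Rightarrow> real"
  assumes omega_pos: "0 < \<omega> j"
    and omega_mono: "strict_mono \<omega>"
    and c_square_summable: "summable (\<lambda>j. (c s j)\<^sup>2)"
    and gamma_pos: "0 < \<gamma> s"
    and omega_series: "summable (\<lambda>i. 1 / (\<omega> i)\<^sup>2)"
    and c_nonzero: "\<exists>s. c s j \<noteq> 0"
begin

section \<open>The feedback operator and its dissipation\<close>

definition cv :: "'r \<Rightarrow> ell2" where "cv s = ell2_of (c s)"

lemma cv_nth [simp]: "ell2_nth (cv s) j = c s j"
  by (simp add: cv_def ell2_nth_ell2_of c_square_summable)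

definition feedback :: "ell2 \<Rightarrow> ell2" where
  "feedback \<xi> = (\<Sum>s\<in>UNIV. (\<gamma> s * inner (cv s) \<xi>) *\<^sub>R cv s)"

definition K :: "H \<Rightarrow> H" where "K z = (feedback (fst z), 0)"

lemma op_F_op_C: "op_F (\<lambda>j s. \<gamma> s * c s j) (\<lambda>j s. 0) (op_C c z) = K z"
proof -
  have "op_C c z $ s = inner (cv s) (fst z)" for s
    by (simp add: op_C_def inner_ell2_def split: prod.split)
  moreover have "(\<Sum>s\<in>UNIV. \<gamma> s * c s j * inner (cv s) x) = ell2_nth (feedback x) j" for x j
    unfolding feedback_def
    by (simp add: linear_sum[OF bounded_linear.linear[OF bounded_linear_ell2_nth]] mult.assoc mult.commute[of "c _ _"])
  ultimately have "ell2_of (\<lambda>j. \<Sum>s\<in>UNIV. \<gamma> s * c s j * op_C c z $ s) = feedback (fst z)"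
    by (simp add: ell2_nth_inverse)
  then show ?thesis by (simp add: op_F_def K_def zero_ell2_def)
qed

lemma bounded_linear_feedback: "bounded_linear feedback"
  unfolding feedback_def
  by (intro bounded_linear_sum bounded_linear_scaleR_const bounded_linear_const_mult bounded_linear_inner_right)

lemma bounded_linear_K: "bounded_linear K"
  unfolding K_def
  by (intro bounded_linear_Pair bounded_linear_compose[OF bounded_linear_feedback] bounded_linear_fst bounded_linear_zero)

text \<open>The rate at which the squared norm decreases along orbits, whence the factor 2.\<close>

definition dissipation :: "ell2 \<Rightarrow> real" where
  "dissipation \<xi> = 2 * (\<Sum>s\<in>UNIV. \<gamma> s * (inner (cv s) \<xi>)\<^sup>2)"

lemma dissipation_nonneg: "0 \<le> dissipation \<xi>"
  using gamma_pos by (auto simp: dissipation_def less_imp_le intro!: sum_nonneg mult_nonneg_nonneg)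

lemma inner_K: "2 * inner (K z) z = dissipation (fst z)"
  by (simp add: K_def inner_prod_def feedback_def inner_sum_left dissipation_def power2_eq_square mult.assoc)

text \<open>Each squared output is, up to its weight, one summand of the dissipation. Estimates by
  \<open>sqrt (dissipation \<xi>)\<close> are what \<open>integral_observability\<close>
  takes.\<close>

lemma output_le: "\<bar>inner (cv s) \<xi>\<bar> \<le> 1 / sqrt (2 * \<gamma> s) * sqrt (dissipation \<xi>)"
proof -
  have "\<gamma> s * (inner (cv s) \<xi>)\<^sup>2 \<le> (\<Sum>s\<in>UNIV. \<gamma> s * (inner (cv s) \<xi>)\<^sup>2)"
    by (rule member_le_sum) (use gamma_pos in \<open>auto simp: less_imp_le\<close>)
  then have "sqrt (2 * \<gamma> s * (inner (cv s) \<xi>)\<^sup>2) \<le> sqrt (dissipation \<xi>)"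
    by (simp add: dissipation_def)
  then have "sqrt (2 * \<gamma> s) * \<bar>inner (cv s) \<xi>\<bar> \<le> sqrt (dissipation \<xi>)"
    by (simp add: real_sqrt_mult)
  then show ?thesis using gamma_pos[of s] by (simp add: field_simps)
qed

definition feedback_gain :: real where
  "feedback_gain = (\<Sum>s\<in>UNIV. \<gamma> s * (1 / sqrt (2 * \<gamma> s)) * norm (cv s))"

lemma feedback_gain_nonneg: "0 \<le> feedback_gain"
  unfolding feedback_gain_def using gamma_pos by (auto intro!: sum_nonneg simp: less_imp_le)

lemma norm_feedback_le: "norm (feedback \<xi>) \<le> feedback_gain * sqrt (dissipation \<xi>)"
proof -
  have "norm (feedback \<xi>) \<le> (\<Sum>s\<in>UNIV. \<gamma> s * \<bar>inner (cv s) \<xi>\<bar> * norm (cv s))"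
    unfolding feedback_def by (rule sum_norm_le) (use gamma_pos in \<open>simp add: abs_mult less_imp_le\<close>)
  also have "\<dots> \<le> (\<Sum>s\<in>UNIV. \<gamma> s * (1 / sqrt (2 * \<gamma> s) * sqrt (dissipation \<xi>)) * norm (cv s))"
    by (intro sum_mono mult_right_mono mult_left_mono output_le) (use gamma_pos in \<open>auto simp: less_imp_le\<close>)
  also have "\<dots> = feedback_gain * sqrt (dissipation \<xi>)"
    by (simp add: feedback_gain_def sum_distrib_left ac_simps)
  finally show ?thesis .
qed

definition closed_loop :: "H \<Rightarrow> H" where "closed_loop z = op_A \<omega> z - K z"

lemma closed_loop_dissipative:
  assumes "x \<in> dom_A \<omega>" "y \<in> dom_A \<omega>"
  shows "inner (closed_loop x - closed_loop y) (x - y) \<le> 0"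
proof -
  have "closed_loop x - closed_loop y = op_A \<omega> (x - y) - K (x - y)"
    by (simp add: closed_loop_def dom_A_diff(2)[OF assms] linear_diff[OF bounded_linear.linear[OF bounded_linear_K]])
  then show ?thesis
    using op_A_skew[OF dom_A_diff(1)[OF assms]] inner_K[of "x - y"] dissipation_nonneg[of "fst (x - y)"]
    by (simp add: inner_diff_left)
qed

lemma closed_loop_semigroup_exists: "\<exists>T. c0_semigroup T \<and> is_generator (dom_A \<omega>) closed_loop T"
proof -
  interpret isometry_group "rot \<omega>" by (rule isometry_group_rot)
  interpret perturbed_isometry_group "rot \<omega>" K
  proof (intro perturbed_isometry_group.intro perturbed_isometry_group_axioms.intro isometry_group_rot)
    show "bounded_linear K" by (rule bounded_linear_K)
    show "0 \<le> inner (K z) z" for z using inner_K[of z] dissipation_nonneg[of "fst z"] by simp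
  qed
  show ?thesis
    using c0_semigroup_T generator_T[OF is_generator_rot] by (auto simp: closed_loop_def[abs_def])
qed

section \<open>Multipliers that single out one mode of the output\<close>

lemma omega_at_top: "filterlim \<omega> at_top sequentially"
proof -
  have "(\<lambda>i. sqrt (1 / (\<omega> i)\<^sup>2)) \<longlonglongrightarrow> sqrt 0"
    by (intro tendsto_intros summable_LIMSEQ_zero omega_series)
  then have "(\<lambda>i. inverse (\<omega> i)) \<longlonglongrightarrow> 0"
    using omega_pos by (simp add: real_sqrt_divide inverse_eq_divide less_imp_le)
  then have "filterlim (\<lambda>i. inverse (inverse (\<omega> i))) at_top sequentially"
    by (rule filterlim_inverse_at_top) (simp add: omega_pos)
  then show ?thesis by simp
qed

text \<open>Beyond \<open>\<omega> k + 1\<close> the modulus of the denominator is at least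
  \<open>\<omega> j\<close>, hence at least \<open>\<bar>p j\<bar>\<close>, so the terms are at most
  \<open>(c s j)^2\<close>. As the frequencies tend to infinity, only finitely many indices escape
  this.\<close>

lemma multiplier_summable:
  assumes "\<And>j. \<omega> k + 1 \<le> \<omega> j \<Longrightarrow> \<bar>p j\<bar> \<le> \<omega> j"
  shows "summable (\<lambda>j. (c s j * p j / ((\<omega> k)\<^sup>2 - (\<omega> j)\<^sup>2))\<^sup>2)"
proof -
  obtain N where N: "\<And>j. N \<le> j \<Longrightarrow> \<omega> k + 1 \<le> \<omega> j"
    using omega_at_top by (auto simp: filterlim_at_top eventually_at_top_linorder)
  show ?thesis
  proof (rule summable_comparison_test'[OF c_square_summable])
    fix j assume "N \<le> j"
    then have j: "\<omega> k + 1 \<le> \<omega> j" by (rule N)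
    have "\<bar>p j\<bar> \<le> \<omega> j" by (rule assms[OF j])
    also have "\<dots> \<le> (\<omega> j - \<omega> k) * (\<omega> j + \<omega> k)"
      using mult_mono[of 1 "\<omega> j - \<omega> k" "\<omega> j" "\<omega> j + \<omega> k"] j omega_pos[of k] omega_pos[of j] by simp
    also have "\<dots> = \<bar>(\<omega> k)\<^sup>2 - (\<omega> j)\<^sup>2\<bar>"
    proof -
      have "(\<omega> k)\<^sup>2 \<le> (\<omega> j)\<^sup>2" using j omega_pos[of k] by (intro power_mono) auto
      then show ?thesis by (simp add: power2_eq_square algebra_simps)
    qed
    finally have "\<bar>p j / ((\<omega> k)\<^sup>2 - (\<omega> j)\<^sup>2)\<bar> \<le> 1" by (simp add: divide_le_eq_1)
    then have "\<bar>c s j * (p j / ((\<omega> k)\<^sup>2 - (\<omega> j)\<^sup>2))\<bar> \<le> \<bar>c s j\<bar>"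
      unfolding abs_mult by (rule mult_right_le_one_le[rotated 2]) auto
    then show "norm ((c s j * p j / ((\<omega> k)\<^sup>2 - (\<omega> j)\<^sup>2))\<^sup>2) \<le> (c s j)\<^sup>2"
      by (simp flip: abs_le_square_iff)
  qed
qed

text \<open>Both multipliers vanish at \<open>j = k\<close>, where the denominator is \<open>0\<close>. With them,
  \<open>X = \<langle>mult_xi, \<xi>\<rangle>\<close> and \<open>N = \<langle>mult_eta, \<eta>\<rangle>\<close> form an oscillator of frequency \<open>\<omega> k\<close> driven, up to the
  feedback, by the output minus the contribution of mode \<open>k\<close>.\<close>

definition mult_xi :: "'r \<Rightarrow> nat \<Rightarrow> ell2" where
  "mult_xi s k = ell2_of (\<lambda>j. c s j * \<omega> k / ((\<omega> k)\<^sup>2 - (\<omega> j)\<^sup>2))"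

definition mult_eta :: "'r \<Rightarrow> nat \<Rightarrow> ell2" where
  "mult_eta s k = ell2_of (\<lambda>j. c s j * \<omega> j / ((\<omega> k)\<^sup>2 - (\<omega> j)\<^sup>2))"

lemma mult_nth:
  "ell2_nth (mult_xi s k) j = c s j * \<omega> k / ((\<omega> k)\<^sup>2 - (\<omega> j)\<^sup>2)"
  "ell2_nth (mult_eta s k) j = c s j * \<omega> j / ((\<omega> k)\<^sup>2 - (\<omega> j)\<^sup>2)"
proof -
  have "summable (\<lambda>j. (c s j * \<omega> k / ((\<omega> k)\<^sup>2 - (\<omega> j)\<^sup>2))\<^sup>2)"
    by (rule multiplier_summable) (use omega_pos[of k] in auto)
  then show "ell2_nth (mult_xi s k) j = c s j * \<omega> k / ((\<omega> k)\<^sup>2 - (\<omega> j)\<^sup>2)"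
    by (simp add: mult_xi_def ell2_nth_ell2_of)
  have "summable (\<lambda>j. (c s j * \<omega> j / ((\<omega> k)\<^sup>2 - (\<omega> j)\<^sup>2))\<^sup>2)"
    by (rule multiplier_summable) (use omega_pos in \<open>auto simp: abs_of_pos\<close>)
  then show "ell2_nth (mult_eta s k) j = c s j * \<omega> j / ((\<omega> k)\<^sup>2 - (\<omega> j)\<^sup>2)"
    by (simp add: mult_eta_def ell2_nth_ell2_of)
qed

lemma inner_mult_xi:
  assumes "z \<in> dom_A \<omega>"
  shows "inner (mult_xi s k) (fst (op_A \<omega> z)) = \<omega> k * inner (mult_eta s k) (snd z)"
  unfolding inner_ell2_def suminf_mult[OF ell2_inner_summable, symmetric]
  by (simp add: op_A_nth[OF assms] mult_nth ac_simps)

text \<open>With \<open>D\<close> the denominator,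
  \<open>- (\<omega> j)^2 / D = 1 - (\<omega> k)^2 / D\<close> for indices other than
  \<open>k\<close>. At \<open>k\<close> both multipliers are 0, so the output appears without its
  own term of mode \<open>k\<close>.\<close>

lemma inner_mult_eta:
  assumes z: "z \<in> dom_A \<omega>"
  shows "inner (mult_eta s k) (snd (op_A \<omega> z)) =
    inner (cv s) (fst z) - c s k * ell2_nth (fst z) k - \<omega> k * inner (mult_xi s k) (fst z)"
proof -
  let ?x = "ell2_nth (fst z)"
  have "(\<lambda>j. c s j * ?x j - (if j = k then c s j * ?x j else 0) - \<omega> k * (ell2_nth (mult_xi s k) j * ?x j))
      sums (inner (cv s) (fst z) - c s k * ?x k - \<omega> k * inner (mult_xi s k) (fst z))"
    using summable_sums[OF ell2_inner_summable[of "cv s" "fst z"]]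
      summable_sums[OF ell2_inner_summable[of "mult_xi s k" "fst z"]]
    by (intro sums_diff sums_mult sums_single) (simp_all add: inner_ell2_def)
  moreover have "c s j * ?x j - (if j = k then c s j * ?x j else 0) - \<omega> k * (ell2_nth (mult_xi s k) j * ?x j)
      = ell2_nth (mult_eta s k) j * ell2_nth (snd (op_A \<omega> z)) j" for j
  proof (cases "j = k")
    case False
    \<comment> \<open>Strict monotonicity excludes resonance: distinct modes have distinct
      frequencies, so the denominator is nonzero.\<close>
    then have "\<omega> k \<noteq> \<omega> j" using omega_mono by (simp add: strict_mono_eq)
    then have "(\<omega> k)\<^sup>2 - (\<omega> j)\<^sup>2 \<noteq> 0"
      using omega_pos by (simp add: power2_eq_iff_nonneg less_imp_le)
    then show ?thesis using False
      by (simp add: mult_nth op_A_nth[OF z] field_simps power2_eq_square)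
  qed (simp add: mult_nth)
  ultimately show ?thesis by (simp add: inner_ell2_def sums_iff)
qed

section \<open>Decay of the closed-loop orbits\<close>

context
  fixes T :: "real \<Rightarrow> H \<Rightarrow> H"
  assumes T: "c0_semigroup T" and gen: "is_generator (dom_A \<omega>) closed_loop T"
begin

lemma orbit_contraction: "0 \<le> t \<Longrightarrow> norm (T t x - T t y) \<le> norm (x - y)"
  by (rule dissipative_contraction[OF T gen T gen closed_loop_dissipative closure_dom_A])

lemma orbit_norm_le: "0 \<le> t \<Longrightarrow> norm (T t x) \<le> norm x"
  using orbit_contraction[of t x 0] linear_0[OF bounded_linear.linear[OF c0_bounded_linear[OF T]]] by simp

text \<open>\<open>closed_loop (T t x) = T t (closed_loop x)\<close> is bounded by contractivity,
  and \<open>op_A\<close> differs from \<open>closed_loop\<close> by the bounded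
  \<open>K\<close>.\<close>

lemma orbit_op_A_bounded:
  assumes x: "x \<in> dom_A \<omega>"
  obtains R where "\<And>t. 0 \<le> t \<Longrightarrow> norm (op_A \<omega> (T t x)) \<le> R"
proof -
  obtain k where k: "0 \<le> k" "\<And>z. norm (K z) \<le> norm z * k"
    using bounded_linear.nonneg_bounded[OF bounded_linear_K] by blast
  show thesis
  proof (rule that)
    fix t :: real assume t: "0 \<le> t"
    have "op_A \<omega> (T t x) = T t (closed_loop x) + K (T t x)"
      using generator_orbit(2)[OF T gen x t] by (simp add: closed_loop_def algebra_simps)
    then have "norm (op_A \<omega> (T t x)) \<le> norm (T t (closed_loop x)) + norm (K (T t x))"
      by (simp add: norm_triangle_ineq)
    also have "\<dots> \<le> norm (closed_loop x) + norm x * k"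
      using k(2)[of "T t x"] mult_right_mono[OF orbit_norm_le[OF t, of x] k(1)] orbit_norm_le[OF t, of "closed_loop x"]
      by linarith
    finally show "norm (op_A \<omega> (T t x)) \<le> norm (closed_loop x) + norm x * k" .
  qed
qed

text \<open>The mode \<open>(\<alpha>, \<beta>)\<close> and the auxiliary pair \<open>(X, N)\<close>
  oscillate with the same frequency, and the mode drives the pair through the term
  \<open>- c s k * \<alpha>\<close> in the derivative of \<open>N\<close>. Since \<open>X\<close>
  and \<open>N\<close> stay bounded, this resonant forcing cannot persist;
  \<open>integral_observability\<close> makes that precise.\<close>

lemma mode_tendsto_zero:
  assumes x: "x \<in> dom_A \<omega>"
  shows "((\<lambda>t. (ell2_nth (fst (T t x)) k)\<^sup>2 + (ell2_nth (snd (T t x)) k)\<^sup>2) \<longlongrightarrow> 0) at_top"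
proof -
  obtain s where s: "c s k \<noteq> 0" using c_nonzero by blast
  define \<xi> where "\<xi> t = fst (T t x)" for t
  define \<eta> where "\<eta> t = snd (T t x)" for t
  define w where "w t = feedback (\<xi> t)" for t
  define \<alpha> where "\<alpha> t = ell2_nth (\<xi> t) k" for t
  define \<beta> where "\<beta> t = ell2_nth (\<eta> t) k" for t
  define X where "X t = inner (mult_xi s k) (\<xi> t)" for t
  define N where "N t = inner (mult_eta s k) (\<eta> t)" for t
  define y where "y t = inner (cv s) (\<xi> t)" for t
  define e where "e t = dissipation (\<xi> t)" for t
  let ?\<omega> = "\<omega> k" and ?c = "c s k" and ?r = "norm x"
  have dom: "T t x \<in> dom_A \<omega>" if "0 < t" for t
    using that by (intro generator_orbit(1)[OF T gen x]) simp
  have u': "((\<lambda>t. T t x) has_vector_derivative op_A \<omega> (T t x) - K (T t x)) (at t)" if "0 < t" for t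
    using generator_orbit_derivative[OF T gen x that] by (simp add: closed_loop_def)
  have \<xi>': "(\<xi> has_vector_derivative fst (op_A \<omega> (T t x)) - w t) (at t)" if "0 < t" for t
    using bounded_linear.has_vector_derivative[OF bounded_linear_fst u'[OF that]]
    by (simp add: \<xi>_def[abs_def] K_def w_def)
  have \<eta>': "(\<eta> has_vector_derivative snd (op_A \<omega> (T t x))) (at t)" if "0 < t" for t
    using bounded_linear.has_vector_derivative[OF bounded_linear_snd u'[OF that]]
    by (simp add: \<eta>_def[abs_def] K_def)
  have \<alpha>': "(\<alpha> has_real_derivative ?\<omega> * \<beta> t - ell2_nth (w t) k) (at t)" if "0 < t" for t
    using bounded_linear.has_vector_derivative[OF bounded_linear_ell2_nth \<xi>'[OF that], of k]
    by (simp add: has_real_derivative_iff_has_vector_derivative \<alpha>_def[abs_def] \<beta>_def \<eta>_def op_A_nth[OF dom[OF that]])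
  have \<beta>': "(\<beta> has_real_derivative - ?\<omega> * \<alpha> t) (at t)" if "0 < t" for t
    using bounded_linear.has_vector_derivative[OF bounded_linear_ell2_nth \<eta>'[OF that], of k]
    by (simp add: has_real_derivative_iff_has_vector_derivative \<beta>_def[abs_def] \<alpha>_def \<xi>_def op_A_nth[OF dom[OF that]])
  have X': "(X has_real_derivative ?\<omega> * N t - inner (mult_xi s k) (w t)) (at t)" if "0 < t" for t
    using bounded_linear.has_vector_derivative[OF bounded_linear_inner_right \<xi>'[OF that], of "mult_xi s k"]
    by (simp add: has_real_derivative_iff_has_vector_derivative X_def[abs_def] N_def \<eta>_def
        inner_diff_right inner_mult_xi[OF dom[OF that]])
  have N': "(N has_real_derivative y t - ?c * \<alpha> t - ?\<omega> * X t) (at t)" if "0 < t" for t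
    using bounded_linear.has_vector_derivative[OF bounded_linear_inner_right \<eta>'[OF that], of "mult_eta s k"]
    by (simp add: has_real_derivative_iff_has_vector_derivative N_def[abs_def] X_def \<alpha>_def y_def \<xi>_def
        inner_mult_eta[OF dom[OF that]])
  have norm_\<xi>: "norm (\<xi> t) \<le> ?r" and norm_\<eta>: "norm (\<eta> t) \<le> ?r" if "0 < t" for t
    using orbit_norm_le[of t x] norm_fst_le[of "fst (T t x)" "snd (T t x)"] norm_snd_le[of "snd (T t x)" "fst (T t x)"] that
    by (auto simp: \<xi>_def \<eta>_def)
  have \<alpha>_le: "\<bar>\<alpha> t\<bar> \<le> ?r" and \<beta>_le: "\<bar>\<beta> t\<bar> \<le> ?r" if "0 < t" for t
    using order_trans[OF ell2_nth_le_norm norm_\<xi>[OF that]] order_trans[OF ell2_nth_le_norm norm_\<eta>[OF that]]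
    by (auto simp: \<alpha>_def \<beta>_def)
  have X_le: "\<bar>X t\<bar> \<le> norm (mult_xi s k) * ?r" and N_le: "\<bar>N t\<bar> \<le> norm (mult_eta s k) * ?r" if "0 < t" for t
    using order_trans[OF Cauchy_Schwarz_ineq2 mult_left_mono[OF norm_\<xi>[OF that] norm_ge_zero]]
      order_trans[OF Cauchy_Schwarz_ineq2 mult_left_mono[OF norm_\<eta>[OF that] norm_ge_zero]]
    by (auto simp: X_def N_def)
  have e0: "0 \<le> e t" for t by (simp add: e_def dissipation_nonneg)
  have y_le: "\<bar>y t\<bar> \<le> 1 / sqrt (2 * \<gamma> s) * sqrt (e t)" for t
    unfolding y_def e_def by (rule output_le)
  let ?g = feedback_gain
  have w_le: "norm (w t) \<le> ?g * sqrt (e t)" for t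
    unfolding w_def e_def by (rule norm_feedback_le)
  have wk_le: "\<bar>ell2_nth (w t) k\<bar> \<le> ?g * sqrt (e t)" for t
    by (rule order_trans[OF ell2_nth_le_norm w_le])
  have wX_le: "\<bar>inner (mult_xi s k) (w t)\<bar> \<le> norm (mult_xi s k) * (?g * sqrt (e t))" for t
    by (rule order_trans[OF Cauchy_Schwarz_ineq2 mult_left_mono[OF w_le norm_ge_zero]])
  \<comment> \<open>In \<open>Q'\<close> the rotation terms of the two oscillators cancel, leaving \<open>- (c s k)\<^sup>2 * \<alpha>\<^sup>2\<close>; the last summand
    of \<open>Q\<close> redistributes this evenly over \<open>\<alpha>\<^sup>2\<close> and \<open>\<beta>\<^sup>2\<close>. The extra factor \<open>c s k\<close> fixes the sign.\<close>
  define Q where "Q t = ?c * (\<alpha> t * N t - \<beta> t * X t) - ?c\<^sup>2 / (2 * ?\<omega>) * (\<alpha> t * \<beta> t)" for t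
  \<comment> \<open>These are the terms containing the output \<open>y\<close> or the feedback
    \<open>w\<close>, all of order \<open>sqrt (e t)\<close>.\<close>
  define rest where "rest t = ?c * (\<alpha> t * y t - ell2_nth (w t) k * N t + \<beta> t * inner (mult_xi s k) (w t))
      + ?c\<^sup>2 / (2 * ?\<omega>) * (ell2_nth (w t) k * \<beta> t)" for t
  have Q': "(Q has_real_derivative - (?c\<^sup>2 / 2) * ((\<alpha> t)\<^sup>2 + (\<beta> t)\<^sup>2) + rest t) (at t)" if "0 < t" for t
    unfolding Q_def[abs_def]
    by (rule derivative_eq_intros \<alpha>'[OF that] \<beta>'[OF that] X'[OF that] N'[OF that] refl)+
      (use omega_pos[of k] in \<open>simp add: rest_def field_simps power2_eq_square\<close>)
  \<comment> \<open>\<open>b\<close> results from bounding every state factor in \<open>rest\<close>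
    along the orbit by a multiple of \<open>norm x\<close>.\<close>
  define b where "b = \<bar>?c\<bar> * (?r * (1 / sqrt (2 * \<gamma> s)) + ?g * (norm (mult_eta s k) * ?r)
      + ?r * (norm (mult_xi s k) * ?g)) + ?c\<^sup>2 / (2 * ?\<omega>) * (?g * ?r)"
  have rest_le: "rest t \<le> b * sqrt (e t)" if "0 < t" for t
  proof -
    have 1: "\<bar>\<alpha> t * y t\<bar> \<le> ?r * (1 / sqrt (2 * \<gamma> s) * sqrt (e t))"
      unfolding abs_mult by (intro mult_mono \<alpha>_le that y_le) auto
    have 2: "\<bar>ell2_nth (w t) k * N t\<bar> \<le> ?g * sqrt (e t) * (norm (mult_eta s k) * ?r)"
      unfolding abs_mult by (intro mult_mono wk_le that N_le) (auto simp: feedback_gain_nonneg e0)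
    have 3: "\<bar>\<beta> t * inner (mult_xi s k) (w t)\<bar> \<le> ?r * (norm (mult_xi s k) * (?g * sqrt (e t)))"
      unfolding abs_mult by (intro mult_mono \<beta>_le that wX_le) auto
    have 4: "\<bar>ell2_nth (w t) k * \<beta> t\<bar> \<le> ?g * sqrt (e t) * ?r"
      unfolding abs_mult by (intro mult_mono \<beta>_le that wk_le) (auto simp: feedback_gain_nonneg e0)
    let ?z = "\<alpha> t * y t - ell2_nth (w t) k * N t + \<beta> t * inner (mult_xi s k) (w t)"
    have "?c * ?z \<le> \<bar>?c\<bar> * \<bar>?z\<bar>" using abs_ge_self[of "?c * ?z"] by (simp add: abs_mult)
    also have "\<dots> \<le> \<bar>?c\<bar> * (?r * (1 / sqrt (2 * \<gamma> s) * sqrt (e t)) + ?g * sqrt (e t) * (norm (mult_eta s k) * ?r)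
        + ?r * (norm (mult_xi s k) * (?g * sqrt (e t))))"
      by (intro mult_left_mono) (use 1 2 3 in linarith, simp)
    finally have "rest t \<le> \<dots> + ?c\<^sup>2 / (2 * ?\<omega>) * (?g * sqrt (e t) * ?r)"
      unfolding rest_def
      by (intro add_mono mult_left_mono order_trans[OF abs_ge_self 4]) (use omega_pos[of k] in auto)
    also have "\<dots> = b * sqrt (e t)"
      by (simp add: b_def algebra_simps)
    finally show ?thesis .
  qed
  have Q_le: "\<bar>Q t\<bar> \<le> \<bar>?c\<bar> * (?r * (norm (mult_eta s k) * ?r) + ?r * (norm (mult_xi s k) * ?r))
      + ?c\<^sup>2 / (2 * ?\<omega>) * (?r * ?r)" if "0 < t" for t
  proof -
    have "\<bar>\<alpha> t * N t\<bar> \<le> ?r * (norm (mult_eta s k) * ?r)" "\<bar>\<beta> t * X t\<bar> \<le> ?r * (norm (mult_xi s k) * ?r)"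
      unfolding abs_mult using that by (intro mult_mono \<alpha>_le \<beta>_le N_le X_le; simp)+
    then have "\<bar>?c\<bar> * \<bar>\<alpha> t * N t - \<beta> t * X t\<bar> \<le> \<bar>?c\<bar> * (?r * (norm (mult_eta s k) * ?r) + ?r * (norm (mult_xi s k) * ?r))"
      by (intro mult_left_mono) auto
    moreover have "\<bar>\<alpha> t * \<beta> t\<bar> \<le> ?r * ?r"
      unfolding abs_mult using that by (intro mult_mono \<alpha>_le \<beta>_le) auto
    then have "?c\<^sup>2 / (2 * ?\<omega>) * \<bar>\<alpha> t * \<beta> t\<bar> \<le> ?c\<^sup>2 / (2 * ?\<omega>) * (?r * ?r)"
      using omega_pos[of k] by (intro mult_left_mono) auto
    moreover have "\<bar>Q t\<bar> \<le> \<bar>?c\<bar> * \<bar>\<alpha> t * N t - \<beta> t * X t\<bar> + ?c\<^sup>2 / (2 * ?\<omega>) * \<bar>\<alpha> t * \<beta> t\<bar>"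
      unfolding Q_def
      by (rule order_trans[OF abs_triangle_ineq4]) (use omega_pos[of k] in \<open>simp add: abs_mult\<close>)
    ultimately show ?thesis by linarith
  qed
  \<comment> \<open>The rotation conserves the energy of the mode, so only the feedback enters its
    derivative.\<close>
  have f': "((\<lambda>t. (\<alpha> t)\<^sup>2 + (\<beta> t)\<^sup>2) has_real_derivative - 2 * \<alpha> t * ell2_nth (w t) k) (at t)" if "0 < t" for t
    by (rule derivative_eq_intros \<alpha>'[OF that] \<beta>'[OF that] refl)+ (simp add: algebra_simps)
  have f'_le: "- (2 * ?r * ?g) * sqrt (e t) \<le> - 2 * \<alpha> t * ell2_nth (w t) k" if "0 < t" for t
  proof -
    have "\<bar>\<alpha> t * ell2_nth (w t) k\<bar> \<le> ?r * (?g * sqrt (e t))"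
      unfolding abs_mult using that by (intro mult_mono \<alpha>_le wk_le) auto
    then show ?thesis by (simp add: abs_le_iff)
  qed
  \<comment> \<open>By skewness of \<open>op_A\<close> only the feedback contributes.\<close>
  have E': "((\<lambda>t. (norm (T t x))\<^sup>2) has_real_derivative - e t) (at t)" if "0 < t" for t
  proof -
    have "inner (op_A \<omega> (T t x) - K (T t x)) (T t x) = - inner (K (T t x)) (T t x)"
      by (simp add: inner_diff_left op_A_skew[OF dom[OF that]])
    then show ?thesis
      using has_real_derivative_inner[OF u'[OF that] u'[OF that]] inner_K[of "T t x"]
      by (simp add: power2_norm_eq_inner inner_commute[of "T t x"] e_def \<xi>_def flip: mult_2)
  qed
  have "((\<lambda>t. (\<alpha> t)\<^sup>2 + (\<beta> t)\<^sup>2) \<longlongrightarrow> 0) at_top"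
  proof (rule integral_observability[OF E' _ e0 f' f'_le _ Q' _ Q_le])
    show "- (?c\<^sup>2 / 2) * ((\<alpha> t)\<^sup>2 + (\<beta> t)\<^sup>2) + rest t \<le> - (?c\<^sup>2 / 2) * ((\<alpha> t)\<^sup>2 + (\<beta> t)\<^sup>2) + b * sqrt (e t)"
      if "0 < t" for t using rest_le[OF that] by simp
    show "0 < ?c\<^sup>2 / 2" using s by simp
    show "0 \<le> 2 * ?r * ?g" using feedback_gain_nonneg by simp
  qed simp_all
  then show ?thesis by (simp add: \<alpha>_def \<beta>_def \<xi>_def \<eta>_def)
qed

text \<open>The bound \<open>R\<close> on \<open>op_A\<close> along the orbit bounds the coordinates
  by \<open>R / \<omega> j\<close>, square-summable by \<open>omega_series\<close>; this stands in
  for compactness of the orbit.\<close>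

lemma orbit_tendsto_zero_dom_A:
  assumes x: "x \<in> dom_A \<omega>"
  shows "((\<lambda>t. T t x) \<longlongrightarrow> 0) at_top"
proof -
  obtain R where R: "\<And>t. 0 \<le> t \<Longrightarrow> norm (op_A \<omega> (T t x)) \<le> R"
    using orbit_op_A_bounded[OF x] by blast
  have *: "((\<lambda>t. a t) \<longlongrightarrow> 0) at_top" if "((\<lambda>t. (a t)\<^sup>2 + (b t)\<^sup>2) \<longlongrightarrow> 0) at_top" for a b :: "real \<Rightarrow> real"
  proof (rule Lim_null_comparison)
    have "((\<lambda>t. sqrt ((a t)\<^sup>2 + (b t)\<^sup>2)) \<longlongrightarrow> sqrt 0) at_top" by (intro tendsto_intros that)
    then show "((\<lambda>t. sqrt ((a t)\<^sup>2 + (b t)\<^sup>2)) \<longlongrightarrow> 0) at_top" by simp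
    show "\<forall>\<^sub>F t in at_top. norm (a t) \<le> sqrt ((a t)\<^sup>2 + (b t)\<^sup>2)"
      by (intro always_eventually allI) (simp add: real_le_rsqrt)
  qed
  show ?thesis
  proof (rule H_tendsto_zero)
    fix j
    show "((\<lambda>t. ell2_nth (fst (T t x)) j) \<longlongrightarrow> 0) at_top"
      using mode_tendsto_zero[OF x, of j] by (rule *)
    show "((\<lambda>t. ell2_nth (snd (T t x)) j) \<longlongrightarrow> 0) at_top"
      using mode_tendsto_zero[OF x, of j] unfolding add.commute[of "(ell2_nth (fst _) j)\<^sup>2"] by (rule *)
  next
    show "summable (\<lambda>j. (R * (1 / \<omega> j))\<^sup>2)"
      by (rule summable_square_scale) (simp add: power_divide omega_series)
    show "\<forall>\<^sub>F t in at_top. \<forall>j. \<bar>ell2_nth (fst (T t x)) j\<bar> \<le> R * (1 / \<omega> j) \<and> \<bar>ell2_nth (snd (T t x)) j\<bar> \<le> R * (1 / \<omega> j)"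
    proof (rule eventually_mono[OF eventually_ge_at_top[of 0]], intro allI)
      fix t :: real and j assume t: "0 \<le> t"
      have dom: "T t x \<in> dom_A \<omega>" by (rule generator_orbit(1)[OF T gen x t])
      have "\<bar>ell2_nth (fst (op_A \<omega> (T t x))) j\<bar> \<le> R" "\<bar>ell2_nth (snd (op_A \<omega> (T t x))) j\<bar> \<le> R"
        using R[OF t] ell2_nth_le_norm[of "fst (op_A \<omega> (T t x))" j] ell2_nth_le_norm[of "snd (op_A \<omega> (T t x))" j]
          norm_fst_le[of "fst (op_A \<omega> (T t x))" "snd (op_A \<omega> (T t x))"]
          norm_snd_le[of "snd (op_A \<omega> (T t x))" "fst (op_A \<omega> (T t x))"] by auto
      then show "\<bar>ell2_nth (fst (T t x)) j\<bar> \<le> R * (1 / \<omega> j) \<and> \<bar>ell2_nth (snd (T t x)) j\<bar> \<le> R * (1 / \<omega> j)"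
        using omega_pos[of j] by (simp add: op_A_nth[OF dom] abs_mult field_simps)
    qed
  qed
qed

text \<open>Approximate \<open>x\<close> by some \<open>y\<close> in the domain; contractivity keeps
  the two orbits within \<open>d / 2\<close>.\<close>

lemma orbit_tendsto_zero: "((\<lambda>t. T t x) \<longlongrightarrow> 0) at_top"
proof (rule tendstoI)
  fix d :: real assume d: "0 < d"
  obtain y where y: "y \<in> dom_A \<omega>" "dist y x < d / 2"
    using closure_dom_A closure_approachable[of x "dom_A \<omega>"] d by (metis UNIV_I half_gt_zero)
  have "\<forall>\<^sub>F t in at_top. dist (T t y) 0 < d / 2"
    by (rule tendstoD[OF orbit_tendsto_zero_dom_A[OF y(1)]]) (use d in simp)
  then show "\<forall>\<^sub>F t in at_top. dist (T t x) 0 < d"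
  proof (rule eventually_elim2[OF _ eventually_ge_at_top[of 0]])
    fix t :: real assume t: "dist (T t y) 0 < d / 2" "0 \<le> t"
    have "norm (T t x) \<le> norm (T t y) + norm (T t x - T t y)" by (rule norm_triangle_sub)
    also have "\<dots> < d" using t y(2) orbit_contraction[OF t(2), of x y] by (simp add: dist_norm norm_minus_commute)
    finally show "dist (T t x) 0 < d" by simp
  qed
qed

end

lemma closed_loop_asymptotically_stable:
  "asymptotically_stable (generated_semigroup (dom_A \<omega>) closed_loop)"
proof -
  obtain T where T: "c0_semigroup T" "is_generator (dom_A \<omega>) closed_loop T"
    using closed_loop_semigroup_exists by blast
  have eq: "generated_semigroup (dom_A \<omega>) closed_loop t x = T t x" if "0 \<le> t" for t x
    by (rule generated_semigroup_eq[OF T closed_loop_dissipative closure_dom_A that])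
  show ?thesis
    unfolding asymptotically_stable_def
  proof (intro conjI allI impI)
    fix \<epsilon> :: real assume "0 < \<epsilon>"
    \<comment> \<open>Contractivity allows \<open>\<delta> = \<epsilon>\<close>.\<close>
    then show "\<exists>\<delta>>0. \<forall>x. norm x < \<delta> \<longrightarrow> (\<forall>t\<ge>0. norm (generated_semigroup (dom_A \<omega>) closed_loop t x) < \<epsilon>)"
      using orbit_norm_le[OF T] by (auto simp: eq intro!: exI[of _ \<epsilon>] intro: le_less_trans)
  next
    fix x
    \<comment> \<open>\<open>generated_semigroup\<close> is identified with \<open>T\<close> at
      nonnegative times only, so the limit is transferred through eventual equality.\<close>
    have "\<forall>\<^sub>F t in at_top. T t x = generated_semigroup (dom_A \<omega>) closed_loop t x"
      by (rule eventually_mono[OF eventually_ge_at_top[of 0]]) (simp add: eq)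
    then show "((\<lambda>t. generated_semigroup (dom_A \<omega>) closed_loop t x) \<longlongrightarrow> 0) at_top"
      by (rule Lim_transform_eventually[OF orbit_tendsto_zero[OF T]])
  qed
qed

end

theorem theorem1:
  fixes \<omega> :: "nat \<Rightarrow> real"
    and c :: "'r::finite \<Rightarrow> nat \<Rightarrow> real"
    and \<gamma> :: "'r \<Rightarrow> real"
    and A :: "H \<Rightarrow> H"
    and C :: "H \<Rightarrow> real ^ 'r"
    and F :: "real ^ 'r \<Rightarrow> H"
  defines "A \<equiv> op_A \<omega>"
    and "C \<equiv> op_C c"
    and "F \<equiv> op_F (\<lambda>j s. \<gamma> s * c s j) (\<lambda>j s. 0)"
  assumes omega_pos: "\<And>j. 0 < \<omega> j"
    and omega_mono: "strict_mono \<omega>"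
    and c_square_summable: "\<And>s. summable (\<lambda>j. (c s j)\<^sup>2)"
    and gamma_pos: "\<And>s. 0 < \<gamma> s"
    and omega_series: "summable (\<lambda>i. 1 / (\<omega> i)\<^sup>2)"
    and observable: "\<And>M. subspace M \<Longrightarrow> M \<subseteq> {z. C z = 0} \<Longrightarrow>
          (\<forall>t\<ge>0. generated_semigroup (dom_A \<omega>) A t ` M \<subseteq> M) \<Longrightarrow> M = {0}"
    and c_nonzero: "\<And>j. \<exists>s. c s j \<noteq> 0"
  shows "asymptotically_stable (generated_semigroup (dom_A \<omega>) (\<lambda>e. A e - F (C e)))"
proof -
  interpret observer \<omega> c \<gamma>
    by (rule observer.intro) (fact omega_pos omega_mono c_square_summable gamma_pos omega_series c_nonzero)+
  show ?thesis
    using closed_loop_asymptotically_stable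
    by (simp add: A_def C_def F_def op_F_op_C closed_loop_def[abs_def])
qed

end
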